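(* (Dimension-dependent weights.) Let $\psi$ satisfy the integrability condition (I) of the context for $p=1$ (hence for every $p\in[1,\infty]$). For $d\in\mathbb N$ let $\boldsymbol\gamma^{[d]}=(\gamma_{d,\mathfrak u})_{\mathfrak u\subseteq[1:d]}$ with $\gamma_{d,\mathfrak u}=d^{-|\mathfrak u|}$. Then for $q\in\{1,\infty\}$ $$\|\imath_{1,q,\psi,\boldsymbol\gamma^{[d]}}\|=(1+\kappa_\psi/d)^d\le\exp(\kappa_\psi)\quad\text{and}\quad\|\imath_{\infty,q,\psi,\boldsymbol\gamma^{[d]}}\|=(1+m_\psi/d)^d\le\exp(m_\psi),$$ and for all $p,q\in[1,\infty]$ the weighted anchored and ANOVA norms are uniformly equivalent, i.e. $\sup_{d\in\mathbb N}\|\imath_{p,q,\psi,\boldsymbol\gamma^{[d]}}\|<\infty$.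
   Context: Setting. $D$ is an interval, either $D=[0,T)$ with $T\in(0,\infty]$ or $D=[0,T]$ with $T\in(0,\infty)$; $\psi:D\to[0,\infty)$ is a probability density function (with respect to Lebesgue measure) that is positive almost everywhere. $d$ is a positive integer, $[1:d]=\{1,\dots,d\}$, and $\mathfrak u$ denotes subsets of $[1:d]$. For $\mathfrak u\neq\emptyset$, $D^{\mathfrak u}$ is the set of points $\boldsymbol x_{\mathfrak u}=(x_j)_{j\in\mathfrak u}$ with $x_j\in D$; functions on $D^{\mathfrak u}$ are identified with functions on $D^d$ depending only on the variables with indices in $\mathfrak u$. For $1\le p\le\infty$, $p'$ is the conjugate index, $1/p+1/p'=1$. $L_{p,\psi}(D^{\mathfrak u})$ is the Banach space of (classes of) real-valued functions with norm $\|g\|_{L_{p,\psi}(D^{\mathfrak u})}=\left(\int_{D^{\mathfrak u}}|g(\boldsymbol t_{\mathfrak u})|^p\prod_{j\in\mathfrak u}\psi(t_j)\,d\boldsymbol t_{\mathfrak u}\right)^{1/p}$ for $p<\infty$ and the essential supremum norm for $p=\infty$. $L_p^{\mathrm{loc}}(D)$ is the set of functions on $D$ whose restriction to $[0,x)$ is in $L_p([0,x))$ for all $x\in D$. Put $\overline\psi(t)=\int_t^T\psi(y)\,dy$. Integrability condition (I) for $p$ and $\psi$: either $p=\infty$ and $\overline\psi\in L_1(D)$; or $p<\infty$, $\psi^{-1/p}\in L_{p'}^{\mathrm{loc}}(D)$ and $\overline\psi\cdot\psi^{-1/p}\in L_{p'}(D)$. If (I) holds for $p=1$ then it holds for all $p\in[1,\infty]$,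 and $m_\psi:=\int_D\overline\psi(t)\,dt=\int_D y\,\psi(y)\,dy\in(0,\infty)$, $\kappa_\psi:=\|\overline\psi/\psi\|_{L_\infty(D)}\in(0,\infty)$. Kernels: $K_\pitchfork(x,t)=1_{[0,x)}(t)$, $K_A(x,t)=1_{[0,x)}(t)-\overline\psi(t)$ for $x,t\in D$, and $K_{\star,\mathfrak u}(\boldsymbol x_{\mathfrak u},\boldsymbol t_{\mathfrak u})=\prod_{j\in\mathfrak u}K_\star(x_j,t_j)$ for $\star\in\{\pitchfork,A\}$. For $\mathfrak u\ne\emptyset$ and $g_{\mathfrak u}\in L_{p,\psi}(D^{\mathfrak u})$ put $T_{\star,\mathfrak u}(g_{\mathfrak u})=\int_{D^{\mathfrak u}}g_{\mathfrak u}(\boldsymbol t_{\mathfrak u})K_{\star,\mathfrak u}(\cdot_{\mathfrak u},\boldsymbol t_{\mathfrak u})\,d\boldsymbol t_{\mathfrak u}$. For $\mathfrak u=\emptyset$, $L_{p,\psi}(D^\emptyset)=\mathbb R$ with norm $|\cdot|$ and $T_{\star,\emptyset}(c)$ is the constant function $c$. Let $F_{\star,p,\psi,\mathfrak u}=T_{\star,\mathfrak u}(L_{p,\psi}(D^{\mathfrak u}))$; the maps $T_{\star,\mathfrak u}$ are one-to-one, and $\|T_{\star,\mathfrak u}(g)\|_{F_{\star,p,\psi,\mathfrak u}}:=\|g\|_{L_{p,\psi}(D^{\mathfrak u})}$. The sum of the spaces $F_{\star,p,\psi,\mathfrak u}$ over $\mathfrak u\subseteq[1:d]$ (inside the continuous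 functions on $D^d$) is direct. For positive weights $\boldsymbol\gamma=(\gamma_{\mathfrak u})_{\mathfrak u\subseteq[1:d]}$, $\star\in\{\pitchfork,A\}$ and $1\le q\le\infty$, $W_{\star,p,q,\psi,\boldsymbol\gamma}=\bigoplus_{\mathfrak u\subseteq[1:d]}F_{\star,p,\psi,\mathfrak u}$, a space of functions $f=\sum_{\mathfrak u\subseteq[1:d]}T_{\star,\mathfrak u}(g_{\star,\mathfrak u})$ on $D^d$, with norm $\|f\|_{W_{\star,p,q,\psi,\boldsymbol\gamma}}=\left(\sum_{\mathfrak u}(\|g_{\star,\mathfrak u}\|_{L_{p,\psi}(D^{\mathfrak u})}/\gamma_{\mathfrak u})^q\right)^{1/q}$ for $q<\infty$ and the maximum over $\mathfrak u$ for $q=\infty$. ($\star=\pitchfork$: anchored; $\star=A$: ANOVA.) The two spaces coincide as vector spaces; $\imath_{p,q,\psi,\boldsymbol\gamma}$ is the identity map from $W_{A,p,q,\psi,\boldsymbol\gamma}$ to $W_{\pitchfork,p,q,\psi,\boldsymbol\gamma}$, and $\|\imath_{p,q,\psi,\boldsymbol\gamma}\|=\|\imath_{p,q,\psi,\boldsymbol\gamma}^{-1}\|$ is its operator norm. *)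

theory Defs
  imports "HOL-Analysis.Analysis" "HOL-Probability.Essential_Supremum"
begin

text \<open>
  Exponents are extended: \<open>p :: ennreal\<close> with \<open>1 \<le> p\<close>, so that \<open>p = \<infinity>\<close> is allowed.
\<close>

definition conj_exp :: "ennreal \<Rightarrow> ennreal" where
  "conj_exp p = inverse (1 - inverse p)"

lemma conj_exp_1: "conj_exp 1 = \<infinity>"
  by (simp add: conj_exp_def)

lemma conj_exp_top: "conj_exp \<infinity> = 1"
  by (simp add: conj_exp_def)

definition in_Lp :: "ennreal \<Rightarrow> 'a measure \<Rightarrow> ('a \<Rightarrow> real) \<Rightarrow> bool" where
  "in_Lp p M g \<longleftrightarrow> g \<in> borel_measurable M \<and>
     (if p = \<infinity> then \<exists>C. AE t in M. \<bar>g t\<bar> \<le> C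
      else integrable M (\<lambda>t. \<bar>g t\<bar> powr enn2real p))"

definition Lp_norm :: "ennreal \<Rightarrow> 'a measure \<Rightarrow> ('a \<Rightarrow> real) \<Rightarrow> real" where
  "Lp_norm p M g =
     (if p = \<infinity> then real_of_ereal (esssup M (\<lambda>t. ereal \<bar>g t\<bar>))
      else (\<integral>t. \<bar>g t\<bar> powr enn2real p \<partial>M) powr (1 / enn2real p))"

definition in_Lp_loc :: "ennreal \<Rightarrow> real set \<Rightarrow> (real \<Rightarrow> real) \<Rightarrow> bool" where
  "in_Lp_loc p D g \<longleftrightarrow> (\<forall>x\<in>D. in_Lp p (lebesgue_on {0..<x}) g)"

definition admissible_interval :: "real set \<Rightarrow> bool" where
  "admissible_interval D \<longleftrightarrow>
     D = {0..} \<or> (\<exists>T>0. D = {0..<T}) \<or> (\<exists>T>0. D = {0..T})"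

definition admissible_density :: "real set \<Rightarrow> (real \<Rightarrow> real) \<Rightarrow> bool" where
  "admissible_density D \<psi> \<longleftrightarrow>
     \<psi> \<in> borel_measurable (lebesgue_on D) \<and> (\<forall>t\<in>D. 0 \<le> \<psi> t) \<and>
     integrable (lebesgue_on D) \<psi> \<and> (\<integral>t. \<psi> t \<partial>lebesgue_on D) = 1 \<and>
     (AE t in lebesgue_on D. 0 < \<psi> t)"

definition psibar :: "real set \<Rightarrow> (real \<Rightarrow> real) \<Rightarrow> real \<Rightarrow> real" where
  "psibar D \<psi> t = (\<integral>y. \<psi> y \<partial>lebesgue_on (D \<inter> {t..}))"

definition integrability_condition :: "real set \<Rightarrow> (real \<Rightarrow> real) \<Rightarrow> ennreal \<Rightarrow> bool" where
  "integrability_condition D \<psi> p \<longleftrightarrow>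
     (if p = \<infinity> then in_Lp 1 (lebesgue_on D) (psibar D \<psi>)
      else in_Lp_loc (conj_exp p) D (\<lambda>t. \<psi> t powr (- 1 / enn2real p)) \<and>
           in_Lp (conj_exp p) (lebesgue_on D) (\<lambda>t. psibar D \<psi> t * \<psi> t powr (- 1 / enn2real p)))"

definition m_psi :: "real set \<Rightarrow> (real \<Rightarrow> real) \<Rightarrow> real" where
  "m_psi D \<psi> = (\<integral>t. psibar D \<psi> t \<partial>lebesgue_on D)"

definition kappa_psi :: "real set \<Rightarrow> (real \<Rightarrow> real) \<Rightarrow> real" where
  "kappa_psi D \<psi> = Lp_norm \<infinity> (lebesgue_on D) (\<lambda>t. psibar D \<psi> t / \<psi> t)"

datatype decomp = Anchored | Anova

fun kern :: "decomp \<Rightarrow> real set \<Rightarrow> (real \<Rightarrow> real) \<Rightarrow> real \<Rightarrow> real \<Rightarrow> real" where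
  "kern Anchored D \<psi> x t = indicator {0..<x} t"
| "kern Anova D \<psi> x t = indicator {0..<x} t - psibar D \<psi> t"

text \<open>
  A point of \<open>D\<^sup>u\<close>, \<open>u\<close> a finite set of indices, is an element of \<open>PiE u (\<lambda>_. D)\<close>.
  The product measure lives on the product of the Lebesgue sigma-algebras; every class of
  Lebesgue measurable functions on \<open>D\<^sup>u\<close> has a representative that is measurable for it, so the
  spaces of classes are the usual ones.
\<close>

definition leb_power :: "real set \<Rightarrow> nat set \<Rightarrow> (nat \<Rightarrow> real) measure" where
  "leb_power D u = PiM u (\<lambda>_. lebesgue_on D)"

text \<open>
  The weight is almost everywhere positive, so for \<open>p = \<infinity>\<close> the essential supremum with respect to
  the weighted measure is the one with respect to Lebesgue measure.
\<close>

definition weighted_power :: "real set \<Rightarrow> (real \<Rightarrow> real) \<Rightarrow> nat set \<Rightarrow> (nat \<Rightarrow> real) measure" where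
  "weighted_power D \<psi> u = density (leb_power D u) (\<lambda>t. ennreal (\<Prod>j\<in>u. \<psi> (t j)))"

definition T_op ::
  "decomp \<Rightarrow> real set \<Rightarrow> (real \<Rightarrow> real) \<Rightarrow> nat set \<Rightarrow> ((nat \<Rightarrow> real) \<Rightarrow> real) \<Rightarrow> (nat \<Rightarrow> real) \<Rightarrow> real"
where
  "T_op s D \<psi> u g x = (\<integral>t. g t * (\<Prod>j\<in>u. kern s D \<psi> (x j) (t j)) \<partial>leb_power D u)"

text \<open>
  For \<open>u = {}\<close> the measure is the unit mass at the only point of \<open>D\<^sup>u\<close>, so the general
  definitions give the real numbers with the absolute value, and \<open>T\<close> gives constants:
\<close>

lemma T_op_empty: "T_op s D \<psi> {} g x = g (\<lambda>_. undefined)"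
  by (simp add: T_op_def leb_power_def PiM_empty lebesgue_integral_count_space_finite)

lemma Lp_norm_empty:
  assumes "1 \<le> p"
  shows "Lp_norm p (weighted_power D \<psi> {}) g = \<bar>g (\<lambda>_. undefined)\<bar>"
proof -
  have *: "weighted_power D \<psi> {} = count_space {\<lambda>_. undefined}"
    by (simp add: weighted_power_def leb_power_def PiM_empty density_1)
  have "esssup (count_space {\<lambda>_::nat. undefined :: real}) (\<lambda>t. ereal \<bar>g t\<bar>) =
        esssup (count_space {\<lambda>_::nat. undefined :: real}) (\<lambda>t. ereal \<bar>g (\<lambda>_. undefined)\<bar>)"
    by (rule esssup_AE_cong) (auto simp: AE_count_space)
  also have "\<dots> = ereal \<bar>g (\<lambda>_. undefined)\<bar>"
    by (rule esssup_const) simp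
  finally have "Lp_norm p (weighted_power D \<psi> {}) g = \<bar>g (\<lambda>_. undefined)\<bar>" if "p = \<infinity>"
    using that by (simp add: Lp_norm_def *)
  moreover have "Lp_norm p (weighted_power D \<psi> {}) g = \<bar>g (\<lambda>_. undefined)\<bar>" if "p \<noteq> \<infinity>"
  proof -
    have "enn2real p \<noteq> 0"
      using assms that by (auto simp: enn2real_eq_0_iff)
    then show ?thesis
      using that by (simp add: Lp_norm_def * lebesgue_integral_count_space_finite powr_powr)
  qed
  ultimately show ?thesis
    by blast
qed

text \<open>
  \<open>W_rep s D \<psi> d p f g\<close>: \<open>f\<close>, a function on \<open>D\<^sup>d\<close>, is \<open>\<Sum>\<^sub>u T\<^sub>u (g u)\<close> with \<open>g u\<close> in the weighted
  \<open>L\<^sub>p(D\<^sup>u)\<close>. Under the integrability condition the \<open>g u\<close> are unique up to null sets.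
\<close>

definition W_rep ::
  "decomp \<Rightarrow> real set \<Rightarrow> (real \<Rightarrow> real) \<Rightarrow> nat \<Rightarrow> ennreal \<Rightarrow>
   ((nat \<Rightarrow> real) \<Rightarrow> real) \<Rightarrow> (nat set \<Rightarrow> (nat \<Rightarrow> real) \<Rightarrow> real) \<Rightarrow> bool"
where
  "W_rep s D \<psi> d p f g \<longleftrightarrow>
     (\<forall>u\<in>Pow {1..d}. in_Lp p (weighted_power D \<psi> u) (g u)) \<and>
     f = (\<lambda>x \<in> PiE {1..d} (\<lambda>_. D). \<Sum>u\<in>Pow {1..d}. T_op s D \<psi> u (g u) x)"

definition W_space ::
  "decomp \<Rightarrow> real set \<Rightarrow> (real \<Rightarrow> real) \<Rightarrow> nat \<Rightarrow> ennreal \<Rightarrow> ((nat \<Rightarrow> real) \<Rightarrow> real) set"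
where
  "W_space s D \<psi> d p = {f. \<exists>g. W_rep s D \<psi> d p f g}"

definition weighted_lq :: "nat \<Rightarrow> ennreal \<Rightarrow> (nat set \<Rightarrow> real) \<Rightarrow> (nat set \<Rightarrow> real) \<Rightarrow> real" where
  "weighted_lq d q \<gamma> a =
     (if q = \<infinity> then Max ((\<lambda>u. a u / \<gamma> u) ` Pow {1..d})
      else (\<Sum>u\<in>Pow {1..d}. (a u / \<gamma> u) powr enn2real q) powr (1 / enn2real q))"

definition W_norm ::
  "decomp \<Rightarrow> real set \<Rightarrow> (real \<Rightarrow> real) \<Rightarrow> nat \<Rightarrow> ennreal \<Rightarrow> ennreal \<Rightarrow> (nat set \<Rightarrow> real) \<Rightarrow>
   ((nat \<Rightarrow> real) \<Rightarrow> real) \<Rightarrow> real"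
where
  "W_norm s D \<psi> d p q \<gamma> f =
     (THE r. \<exists>g. W_rep s D \<psi> d p f g \<and>
                 r = weighted_lq d q \<gamma> (\<lambda>u. Lp_norm p (weighted_power D \<psi> u) (g u)))"

text \<open>
  The operator norm of the identity map from the space of kind \<open>s\<close> to the space of kind \<open>s'\<close>.
  It is \<open>\<infinity>\<close> if the map is unbounded, or if it does not map into the second space.
\<close>

definition id_opnorm ::
  "decomp \<Rightarrow> decomp \<Rightarrow> real set \<Rightarrow> (real \<Rightarrow> real) \<Rightarrow> nat \<Rightarrow> ennreal \<Rightarrow> ennreal \<Rightarrow>
   (nat set \<Rightarrow> real) \<Rightarrow> ennreal"
where
  "id_opnorm s s' D \<psi> d p q \<gamma> =
     (SUP f \<in> {f \<in> W_space s D \<psi> d p. W_norm s D \<psi> d p q \<gamma> f \<le> 1}.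
        if f \<in> W_space s' D \<psi> d p then ennreal (W_norm s' D \<psi> d p q \<gamma> f) else \<infinity>)"

definition dim_weight :: "nat \<Rightarrow> nat set \<Rightarrow> real" where
  "dim_weight d u = 1 / real d ^ card u"

end

theory Submission
  imports Defs "HOL-Probability.Infinite_Product_Measure"
begin

text \<open>
  With respect to the probability measure \<open>\<mu>\<close> with density \<open>\<psi>\<close>, the anchored kernel and the ANOVA
  kernel differ by the bounded function \<open>\<rho> = psibar D \<psi> / \<psi>\<close> of the integration variable alone.
  Expanding the products of kernels, a sum of \<open>T\<^sub>u (g u)\<close> of one kind becomes a sum of the other kind
  with components \<open>\<Sum>\<^sub>w \<sigma>\<^sup>|\<^sup>w\<^sup>| \<integral> g (v \<union> w) \<Prod>\<^sub>j\<^sub>\<in>\<^sub>w \<rho>\<close>, where \<open>w\<close> ranges over the subsets disjoint from \<open>v\<close> and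
  \<open>\<sigma> = 1\<close> or \<open>\<sigma> = -1\<close>. Jensen's inequality bounds the integral over the coordinates in \<open>w\<close> by \<open>C\<^sup>|\<^sup>w\<^sup>|\<close>,
  with \<open>C = \<integral> \<rho> d\<mu> = m\<close> if \<open>p = \<infinity>\<close> and \<open>C = \<kappa>\<close> otherwise. With the weights \<open>d\<^sup>-\<^sup>|\<^sup>u\<^sup>|\<close>, Minkowski's
  inequality in \<open>L\<^sub>p\<close> and in \<open>l\<^sub>q\<close> gives the bound \<open>\<Sum>\<^sub>w (C/d)\<^sup>|\<^sup>w\<^sup>| = (1 + C/d)\<^sup>d\<close>. It is attained or
  approached on products \<open>\<Prod>\<^sub>j\<^sub>\<in>\<^sub>u \<phi>\<close>, with \<open>\<phi> = 1\<close> for \<open>p = \<infinity>\<close> and with \<open>\<phi>\<close> concentrated where \<open>\<rho>\<close> is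
  close to \<open>\<kappa>\<close> for \<open>p = 1\<close>.
\<close>

section \<open>Minkowski's inequality\<close>

text \<open>The sets over which \<open>f\<close> integrates to 0 are closed under countable disjoint
  unions, and \<open>total\<close> makes them closed under complements. As \<open>G\<close> is
  closed under intersections, Dynkin's argument reaches every measurable set.\<close>

lemma (in sigma_finite_measure) AE_zero_if_integral_zero_on_generator:
  fixes f :: "'a \<Rightarrow> real"
  assumes f: "integrable M f"
    and gen: "sets M = sigma_sets (space M) G" "Int_stable G" "G \<subseteq> Pow (space M)"
    and total: "(\<integral>x. f x \<partial>M) = 0"
    and zero: "\<And>A. A \<in> G \<Longrightarrow> (LINT x:A|M. f x) = 0"
  shows "AE x in M. f x = 0"
proof (rule density_zero[OF f])
  fix A assume "A \<in> sets M"
  then have "A \<in> sigma_sets (space M) G" by (simp add: gen)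
  with gen(2,3) show "(LINT x:A|M. f x) = 0"
  proof (induction rule: sigma_sets_induct_disjoint)
    case (basic A) then show ?case by (rule zero)
  next
    case empty then show ?case by (simp add: set_lebesgue_integral_def)
  next
    case (compl A)
    then have A: "A \<in> sets M" by (simp add: gen)
    have "(LINT x:space M - A|M. f x) = (\<integral>x. f x - indicator A x * f x \<partial>M)"
      unfolding set_lebesgue_integral_def
      by (intro Bochner_Integration.integral_cong) (auto simp: indicator_def)
    also have "\<dots> = (\<integral>x. f x \<partial>M) - (LINT x:A|M. f x)"
      using f A integrable_mult_indicator[OF A f]
      by (subst Bochner_Integration.integral_diff) (auto simp: set_lebesgue_integral_def)
    finally show ?case using compl total by simp
  next
    case (union A)
    then have A: "\<And>i. A i \<in> sets M" by (auto simp: gen)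
    have "(LINT x:(\<Union>i. A i)|M. f x) = (\<Sum>i. (LINT x:(A i)|M. f x))"
      using A union f integrable_mult_indicator[of "\<Union>i. A i" M f]
      by (intro lebesgue_integral_countable_add)
         (auto simp: disjoint_family_on_def set_integrable_def)
    then show ?case using union by simp
  qed
qed

lemma convex_on_abs_powr:
  fixes p :: real
  assumes p: "1 \<le> p"
  shows "convex_on UNIV (\<lambda>x::real. \<bar>x\<bar> powr p)"
proof (rule convex_onI)
  fix t x y :: real
  assume t: "0 < t" "t < 1"
  \<comment> \<open>If one of the two points is 0, convexity reduces to s powr p <= s for 0 < s < 1;
    \<open>powr_convex\<close> is then only used for nonzero arguments.\<close>
  have small: "(s * z) powr p \<le> s * z powr p" if "0 < s" "s < 1" "0 \<le> z" for s z :: real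
  proof -
    have "s powr p \<le> s powr 1"
      using that p by (intro powr_mono') auto
    then show ?thesis
      using that by (auto simp: powr_mult intro!: mult_right_mono)
  qed
  have "\<bar>(1 - t) * x + t * y\<bar> powr p \<le> ((1 - t) * \<bar>x\<bar> + t * \<bar>y\<bar>) powr p"
    using t p abs_triangle_ineq[of "(1 - t) * x" "t * y"]
    by (intro powr_mono2) (auto simp: abs_mult)
  also have "\<dots> \<le> (1 - t) * \<bar>x\<bar> powr p + t * \<bar>y\<bar> powr p"
  proof (cases "x = 0 \<or> y = 0")
    case True
    then show ?thesis using t small[of t "\<bar>y\<bar>"] small[of "1 - t" "\<bar>x\<bar>"] p by auto
  next
    case False
    then show ?thesis
      using convex_onD[OF powr_convex[OF p], of t "\<bar>x\<bar>" "\<bar>y\<bar>"] t by simp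
  qed
  finally show "\<bar>(1 - t) *\<^sub>R x + t *\<^sub>R y\<bar> powr p \<le> (1 - t) * \<bar>x\<bar> powr p + t * \<bar>y\<bar> powr p"
    by simp
qed auto

text \<open>(x + y) / (a + b) is the mean of x / a and y / b with weights a / (a + b) and b / (a +
  b), so convexity of the p-th power applies. With norm bounds of two functions as \<open>a\<close>
  and \<open>b\<close>, integration yields Minkowski's inequality without Hoelder's.\<close>

lemma abs_powr_add_le:
  fixes p a b x y :: real
  assumes "1 \<le> p" "0 < a" "0 < b"
  shows "\<bar>x + y\<bar> powr p \<le>
    (a + b) powr (p - 1) * (a * (\<bar>x\<bar> powr p / a powr p) + b * (\<bar>y\<bar> powr p / b powr p))"
proof -
  let ?t = "b / (a + b)"
  have t: "1 - ?t = a / (a + b)" using assms by (simp add: field_simps)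
  have "\<bar>(1 - ?t) *\<^sub>R (x / a) + ?t *\<^sub>R (y / b)\<bar> powr p
      \<le> (1 - ?t) * \<bar>x / a\<bar> powr p + ?t * \<bar>y / b\<bar> powr p"
    using assms by (intro convex_onD[OF convex_on_abs_powr]) (auto simp: field_simps)
  moreover have "(1 - ?t) *\<^sub>R (x / a) + ?t *\<^sub>R (y / b) = (x + y) / (a + b)"
    unfolding t using assms by (simp add: add_divide_distrib)
  ultimately have "\<bar>(x + y) / (a + b)\<bar> powr p
      \<le> a / (a + b) * \<bar>x / a\<bar> powr p + ?t * \<bar>y / b\<bar> powr p"
    unfolding t by simp
  moreover have "\<bar>(x + y) / (a + b)\<bar> powr p = \<bar>x + y\<bar> powr p / (a + b) powr p"
    using assms by (simp add: abs_divide powr_divide)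
  moreover have "a / (a + b) * \<bar>x / a\<bar> powr p + ?t * \<bar>y / b\<bar> powr p
      = (a * (\<bar>x\<bar> powr p / a powr p) + b * (\<bar>y\<bar> powr p / b powr p)) / (a + b)"
    using assms by (simp add: abs_divide powr_divide add_divide_distrib mult_ac)
  ultimately have "\<bar>x + y\<bar> powr p / (a + b) powr p
      \<le> (a * (\<bar>x\<bar> powr p / a powr p) + b * (\<bar>y\<bar> powr p / b powr p)) / (a + b)"
    by simp
  then have "\<bar>x + y\<bar> powr p
      \<le> (a * (\<bar>x\<bar> powr p / a powr p) + b * (\<bar>y\<bar> powr p / b powr p)) / (a + b) * (a + b) powr p"
    using assms by (subst (asm) pos_divide_le_eq) auto
  also have "\<dots> = (a + b) powr (p - 1) * (a * (\<bar>x\<bar> powr p / a powr p) + b * (\<bar>y\<bar> powr p / b powr p))"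
    using assms by (simp add: powr_diff)
  finally show ?thesis .
qed

lemma enn2real_ge_1: "1 \<le> p \<Longrightarrow> p \<noteq> \<infinity> \<Longrightarrow> 1 \<le> enn2real p"
  by (cases p) auto

lemma Lp_norm_nonneg: "emeasure M (space M) \<noteq> 0 \<Longrightarrow> 0 \<le> Lp_norm p M g"
proof (cases "p = \<infinity>")
  case True
  assume M: "emeasure M (space M) \<noteq> 0"
  have "0 \<le> esssup M (\<lambda>t. ereal \<bar>g t\<bar>)"
  proof (cases "(\<lambda>t. ereal \<bar>g t\<bar>) \<in> borel_measurable M")
    case True
    have "esssup M (\<lambda>t. 0::ereal) \<le> esssup M (\<lambda>t. ereal \<bar>g t\<bar>)"
      by (rule esssup_mono) auto
    then show ?thesis by (simp add: esssup_const[OF M])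
  qed (simp add: esssup_non_measurable)
  then show ?thesis using True by (simp add: Lp_norm_def real_of_ereal_pos)
qed (simp add: Lp_norm_def)

text \<open>Membership and norm bound form one statement because \<open>real_of_ereal\<close> sends
  an infinite essential supremum to 0, so the bound alone would say nothing about \<open>g\<close>.
  The nonzero measure bounds the essential supremum below by 0.\<close>

lemma Lp_norm_le_infinity_iff:
  assumes "emeasure M (space M) \<noteq> 0" "0 \<le> C"
  shows "in_Lp \<infinity> M g \<and> Lp_norm \<infinity> M g \<le> C \<longleftrightarrow>
    g \<in> borel_measurable M \<and> (AE t in M. \<bar>g t\<bar> \<le> C)"
proof (intro iffI conjI; elim conjE)
  assume g: "in_Lp \<infinity> M g" and le: "Lp_norm \<infinity> M g \<le> C"
  from g show meas: "g \<in> borel_measurable M" by (simp add: in_Lp_def)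
  from g obtain B where "AE t in M. \<bar>g t\<bar> \<le> B" by (auto simp: in_Lp_def)
  with meas have "esssup M (\<lambda>t. ereal \<bar>g t\<bar>) \<le> ereal B"
    by (intro esssup_I) auto
  moreover have "esssup M (\<lambda>t. 0::ereal) \<le> esssup M (\<lambda>t. ereal \<bar>g t\<bar>)"
    using meas by (intro esssup_mono) auto
  ultimately have "esssup M (\<lambda>t. ereal \<bar>g t\<bar>) = ereal (Lp_norm \<infinity> M g)"
    using assms by (cases "esssup M (\<lambda>t. ereal \<bar>g t\<bar>)") (auto simp: Lp_norm_def esssup_const)
  with esssup_AE[of "\<lambda>t. ereal \<bar>g t\<bar>" M] le show "AE t in M. \<bar>g t\<bar> \<le> C"
    by (auto elim!: eventually_mono)
next
  assume meas: "g \<in> borel_measurable M" and le: "AE t in M. \<bar>g t\<bar> \<le> C"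
  from meas le show "in_Lp \<infinity> M g" by (auto simp: in_Lp_def)
  have "esssup M (\<lambda>t. ereal \<bar>g t\<bar>) \<le> ereal C"
    using meas le by (intro esssup_I) auto
  then show "Lp_norm \<infinity> M g \<le> C"
    using assms(2) by (cases "esssup M (\<lambda>t. ereal \<bar>g t\<bar>)") (auto simp: Lp_norm_def)
qed

lemma Lp_norm_le_finite_iff:
  assumes "1 \<le> p" "p \<noteq> \<infinity>" "0 \<le> C"
  shows "in_Lp p M g \<and> Lp_norm p M g \<le> C \<longleftrightarrow>
    g \<in> borel_measurable M \<and> integrable M (\<lambda>t. \<bar>g t\<bar> powr enn2real p) \<and>
    (\<integral>t. \<bar>g t\<bar> powr enn2real p \<partial>M) \<le> C powr enn2real p"
proof -
  have p: "1 \<le> enn2real p" using assms by (simp add: enn2real_ge_1)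
  have "Lp_norm p M g \<le> C \<longleftrightarrow> Lp_norm p M g powr enn2real p \<le> C powr enn2real p"
    using p assms powr_mono2[of "enn2real p" "Lp_norm p M g" C]
      powr_less_mono2[of "enn2real p" C "Lp_norm p M g"]
    by (auto simp: Lp_norm_def not_le[symmetric])
  also have "Lp_norm p M g powr enn2real p = (\<integral>t. \<bar>g t\<bar> powr enn2real p \<partial>M)"
    using p assms by (simp add: Lp_norm_def powr_powr)
  finally show ?thesis using assms by (auto simp: in_Lp_def)
qed

lemma Lp_norm_AE_cong:
  assumes "g \<in> borel_measurable M" "h \<in> borel_measurable M" "AE t in M. g t = h t"
  shows "Lp_norm p M g = Lp_norm p M h"
proof (cases "p = \<infinity>")
  case True
  have "esssup M (\<lambda>t. ereal \<bar>g t\<bar>) = esssup M (\<lambda>t. ereal \<bar>h t\<bar>)"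
    using assms by (intro esssup_AE_cong) auto
  with True show ?thesis by (simp add: Lp_norm_def)
next
  case False
  have "(\<integral>t. \<bar>g t\<bar> powr enn2real p \<partial>M) = (\<integral>t. \<bar>h t\<bar> powr enn2real p \<partial>M)"
    using assms by (intro integral_cong_AE) auto
  with False show ?thesis by (simp add: Lp_norm_def)
qed

lemma in_Lp_measurable: "in_Lp p M g \<Longrightarrow> g \<in> borel_measurable M"
  by (simp add: in_Lp_def)

text \<open>The weights in \<open>abs_powr_add_le\<close> must be positive, so the norms themselves,
  which may be 0, cannot serve as \<open>B\<close> and \<open>C\<close>. Minkowski's inequality
  follows by taking the norms plus e / 2 and letting e tend to 0.\<close>

lemma Lp_bound_add_pos:
  assumes M: "emeasure M (space M) \<noteq> 0" and p: "1 \<le> p" and C: "0 < B" "0 < C"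
    and f: "in_Lp p M f" "Lp_norm p M f \<le> B" and g: "in_Lp p M g" "Lp_norm p M g \<le> C"
  shows "in_Lp p M (\<lambda>t. f t + g t) \<and> Lp_norm p M (\<lambda>t. f t + g t) \<le> B + C"
proof (cases "p = \<infinity>")
  case True
  have "f \<in> borel_measurable M \<and> (AE t in M. \<bar>f t\<bar> \<le> B)"
    "g \<in> borel_measurable M \<and> (AE t in M. \<bar>g t\<bar> \<le> C)"
    using Lp_norm_le_infinity_iff[OF M] f g C True by (meson less_imp_le)+
  then have "(\<lambda>t. f t + g t) \<in> borel_measurable M \<and> (AE t in M. \<bar>f t + g t\<bar> \<le> B + C)"
    by (auto elim!: eventually_elim2)
  then show ?thesis
    using Lp_norm_le_infinity_iff[OF M, of "B + C"] C True by auto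
next
  case False
  let ?p = "enn2real p"
  have p1: "1 \<le> ?p" using p False by (rule enn2real_ge_1)
  have f': "f \<in> borel_measurable M" "integrable M (\<lambda>t. \<bar>f t\<bar> powr ?p)"
      "(\<integral>t. \<bar>f t\<bar> powr ?p \<partial>M) \<le> B powr ?p"
    using Lp_norm_le_finite_iff[OF p False, of B M f] f C by auto
  have g': "g \<in> borel_measurable M" "integrable M (\<lambda>t. \<bar>g t\<bar> powr ?p)"
      "(\<integral>t. \<bar>g t\<bar> powr ?p \<partial>M) \<le> C powr ?p"
    using Lp_norm_le_finite_iff[OF p False, of C M g] g C by auto
  let ?U = "\<lambda>t. (B + C) powr (?p - 1) *
    (B * (\<bar>f t\<bar> powr ?p / B powr ?p) + C * (\<bar>g t\<bar> powr ?p / C powr ?p))"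
  have le: "\<bar>f t + g t\<bar> powr ?p \<le> ?U t" for t
    using p1 C by (rule abs_powr_add_le)
  have U: "integrable M ?U"
    using f' g' by (auto intro!: integrable_mult_right Bochner_Integration.integrable_add)
  have int: "integrable M (\<lambda>t. \<bar>f t + g t\<bar> powr ?p)"
    using f' g' le by (intro Bochner_Integration.integrable_bound[OF U]) (auto intro: order_trans[OF _ abs_ge_self])
  have "(\<integral>t. \<bar>f t + g t\<bar> powr ?p \<partial>M) \<le> (\<integral>t. ?U t \<partial>M)"
    using int U le by (rule integral_mono)
  also have "\<dots> = (B + C) powr (?p - 1) * (B * ((\<integral>t. \<bar>f t\<bar> powr ?p \<partial>M) / B powr ?p)
      + C * ((\<integral>t. \<bar>g t\<bar> powr ?p \<partial>M) / C powr ?p))"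
    using f' g' by simp
  also have "\<dots> \<le> (B + C) powr (?p - 1) * (B * 1 + C * 1)"
    using f' g' C by (intro mult_left_mono add_mono) auto
  also have "\<dots> = (B + C) powr ?p"
    using C by (simp add: powr_diff)
  finally show ?thesis
    using Lp_norm_le_finite_iff[OF p False, of "B + C" M] int C f' g' by auto
qed

lemma Lp_minkowski:
  assumes M: "emeasure M (space M) \<noteq> 0" and p: "1 \<le> p"
    and f: "in_Lp p M f" and g: "in_Lp p M g"
  shows in_Lp_add: "in_Lp p M (\<lambda>t. f t + g t)"
    and Lp_norm_add_le: "Lp_norm p M (\<lambda>t. f t + g t) \<le> Lp_norm p M f + Lp_norm p M g"
proof -
  have *: "in_Lp p M (\<lambda>t. f t + g t) \<and>
      Lp_norm p M (\<lambda>t. f t + g t) \<le> (Lp_norm p M f + e / 2) + (Lp_norm p M g + e / 2)" if "0 < e" for e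
    using that Lp_norm_nonneg[OF M, of p f] Lp_norm_nonneg[OF M, of p g]
    by (intro Lp_bound_add_pos[OF M p] f g) auto
  from *[of 1] show "in_Lp p M (\<lambda>t. f t + g t)" by simp
  show "Lp_norm p M (\<lambda>t. f t + g t) \<le> Lp_norm p M f + Lp_norm p M g"
  proof (rule field_le_epsilon)
    fix e :: real assume "0 < e"
    with *[of e] show "Lp_norm p M (\<lambda>t. f t + g t) \<le> Lp_norm p M f + Lp_norm p M g + e"
      by linarith
  qed
qed

lemma Lp_sum:
  assumes M: "emeasure M (space M) \<noteq> 0" and p: "1 \<le> p" and I: "finite I"
    and f: "\<And>i. i \<in> I \<Longrightarrow> in_Lp p M (f i)"
  shows in_Lp_sum: "in_Lp p M (\<lambda>t. \<Sum>i\<in>I. f i t)"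
    and Lp_norm_sum_le: "Lp_norm p M (\<lambda>t. \<Sum>i\<in>I. f i t) \<le> (\<Sum>i\<in>I. Lp_norm p M (f i))"
proof -
  have "in_Lp p M (\<lambda>t. \<Sum>i\<in>I. f i t) \<and>
      Lp_norm p M (\<lambda>t. \<Sum>i\<in>I. f i t) \<le> (\<Sum>i\<in>I. Lp_norm p M (f i))"
    using I f
  proof (induction I rule: finite_induct)
    case empty
    show ?case
      using Lp_norm_le_infinity_iff[OF M, of 0 "\<lambda>_. 0"] Lp_norm_le_finite_iff[OF p, of 0 M "\<lambda>_. 0"]
      by (cases "p = \<infinity>") auto
  next
    case (insert i I)
    then show ?case
      using in_Lp_add[OF M p, of "f i" "\<lambda>t. \<Sum>i\<in>I. f i t"]
        Lp_norm_add_le[OF M p, of "f i" "\<lambda>t. \<Sum>i\<in>I. f i t"] by fastforce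
  qed
  then show "in_Lp p M (\<lambda>t. \<Sum>i\<in>I. f i t)"
    "Lp_norm p M (\<lambda>t. \<Sum>i\<in>I. f i t) \<le> (\<Sum>i\<in>I. Lp_norm p M (f i))" by auto
qed

lemma in_Lp_cmult:
  assumes "in_Lp p M g"
  shows "in_Lp p M (\<lambda>t. c * g t)"
proof (cases "p = \<infinity>")
  case True
  with assms obtain B where "g \<in> borel_measurable M" "AE t in M. \<bar>g t\<bar> \<le> B"
    by (auto simp: in_Lp_def)
  then have "AE t in M. \<bar>c * g t\<bar> \<le> \<bar>c\<bar> * B"
    by (auto simp: abs_mult elim!: eventually_mono intro!: mult_left_mono)
  with True assms show ?thesis by (auto simp: in_Lp_def)
next
  case False
  with assms show ?thesis by (auto simp: in_Lp_def abs_mult powr_mult)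
qed

lemma Lp_norm_cmult:
  assumes M: "emeasure M (space M) \<noteq> 0" and p: "1 \<le> p"
  shows "Lp_norm p M (\<lambda>t. c * g t) = \<bar>c\<bar> * Lp_norm p M g"
proof (cases "p = \<infinity>")
  case True
  show ?thesis
  proof (cases "c = 0")
    case False
    then have "esssup M (\<lambda>t. ereal \<bar>c\<bar> * ereal \<bar>g t\<bar>) = ereal \<bar>c\<bar> * esssup M (\<lambda>t. ereal \<bar>g t\<bar>)"
      by (intro esssup_cmult) auto
    then show ?thesis using \<open>p = \<infinity>\<close> by (simp add: Lp_norm_def abs_mult)
  qed (use True in \<open>simp add: Lp_norm_def esssup_const[OF M] flip: zero_ereal_def\<close>)
next
  case False
  then have p1: "1 \<le> enn2real p" using p by (simp add: enn2real_ge_1)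
  have "(\<integral>t. \<bar>g t\<bar> powr enn2real p \<partial>M) \<ge> 0" by simp
  then show ?thesis using False p1
    by (simp add: Lp_norm_def abs_mult powr_mult powr_powr)
qed

text \<open>Constants are integrable on a probability space, and for finite p the bound |x| <= 1 +
  |x|^p supplies a majorant.\<close>

lemma (in prob_space) in_Lp_integrable:
  assumes p: "1 \<le> p" and g: "in_Lp p M g"
  shows "integrable M g"
proof (cases "p = \<infinity>")
  case True
  with g obtain B where "g \<in> borel_measurable M" "AE t in M. \<bar>g t\<bar> \<le> B"
    by (auto simp: in_Lp_def)
  then show ?thesis by (intro integrable_const_bound[of _ B]) auto
next
  case False
  then have p1: "1 \<le> enn2real p" using p by (simp add: enn2real_ge_1)
  have *: "\<bar>x\<bar> \<le> 1 + \<bar>x\<bar> powr enn2real p" for x :: real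
  proof (cases "\<bar>x\<bar> \<le> 1")
    case False
    then have "\<bar>x\<bar> powr 1 \<le> \<bar>x\<bar> powr enn2real p" using p1 by (intro powr_mono) auto
    then show ?thesis using False by simp
  qed (auto intro: order_trans)
  have "integrable M (\<lambda>t. 1 + \<bar>g t\<bar> powr enn2real p)"
    using g False by (auto simp: in_Lp_def)
  then show ?thesis
    using g * by (rule_tac Bochner_Integration.integrable_bound) (auto simp: in_Lp_def intro: order_trans[OF _ abs_ge_self])
qed

section \<open>Integrating out coordinates against a bounded function\<close>

text \<open>For p = infinity the a.e. bound of \<open>G\<close> is pulled out and \<open>r\<close>
  is integrated exactly, which gives the integral of \<open>r\<close> as constant. For finite p,
  \<open>r\<close> is replaced by \<open>R\<close>; Jensen's inequality for the probability measure
  \<open>M2\<close> and then Fubini's theorem bound what remains.\<close>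

lemma Lp_integral_against_bounded:
  fixes r :: "'b \<Rightarrow> real"
  assumes M1: "prob_space M1" and M2: "prob_space M2" and p: "1 \<le> p"
    and G: "in_Lp p (M1 \<Otimes>\<^sub>M M2) G"
    and r[measurable]: "r \<in> borel_measurable M2" and R: "AE y in M2. 0 \<le> r y \<and> r y \<le> R"
  defines "F \<equiv> \<lambda>x. \<integral>y. G (x, y) * r y \<partial>M2"
  shows "in_Lp p M1 F \<and>
    Lp_norm p M1 F \<le> (if p = \<infinity> then \<integral>y. r y \<partial>M2 else R) * Lp_norm p (M1 \<Otimes>\<^sub>M M2) G"
proof -
  interpret M1: prob_space M1 by fact
  interpret M2: prob_space M2 by fact
  interpret P: pair_prob_space M1 M2 ..
  let ?N = "Lp_norm p (M1 \<Otimes>\<^sub>M M2) G"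
  have P0: "emeasure (M1 \<Otimes>\<^sub>M M2) (space (M1 \<Otimes>\<^sub>M M2)) \<noteq> 0"
    by (simp add: P.emeasure_space_1)
  have M10: "emeasure M1 (space M1) \<noteq> 0"
    by (simp add: M1.emeasure_space_1)
  have N0: "0 \<le> ?N" by (rule Lp_norm_nonneg[OF P0])
  have Gm[measurable]: "G \<in> borel_measurable (M1 \<Otimes>\<^sub>M M2)" using G by (rule in_Lp_measurable)
  have Fm[measurable]: "F \<in> borel_measurable M1" unfolding F_def by measurable
  have r_int: "integrable M2 r"
    using R by (intro M2.integrable_const_bound[of _ R]) auto
  have R0: "0 \<le> R"
  proof -
    have "AE y in M2. 0 \<le> R" using R by eventually_elim auto
    then show ?thesis by simp
  qed
  have r0: "0 \<le> (\<integral>y. r y \<partial>M2)"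
    using R by (intro integral_nonneg_AE) auto
  show ?thesis
  proof (cases "p = \<infinity>")
    case True
    have "AE z in M1 \<Otimes>\<^sub>M M2. \<bar>G z\<bar> \<le> ?N"
      using Lp_norm_le_infinity_iff[OF P0 N0, of G] G True by auto
    from P.AE_pair[OF this] have "AE x in M1. \<bar>F x\<bar> \<le> (\<integral>y. r y \<partial>M2) * ?N"
    proof (rule AE_mp, intro AE_I2 impI)
      fix x assume x: "x \<in> space M1" and le: "AE y in M2. \<bar>G (x, y)\<bar> \<le> ?N"
      have [measurable]: "(\<lambda>y. G (x, y)) \<in> borel_measurable M2" using x by measurable
      have le': "AE y in M2. \<bar>G (x, y) * r y\<bar> \<le> ?N * r y"
        using le R by eventually_elim (auto simp: abs_mult intro!: mult_right_mono)
      have "\<bar>F x\<bar> \<le> (\<integral>y. \<bar>G (x, y) * r y\<bar> \<partial>M2)"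
        unfolding F_def by (rule integral_abs_bound)
      also have "\<dots> \<le> (\<integral>y. ?N * r y \<partial>M2)"
      proof (rule integral_mono_AE)
        show "integrable M2 (\<lambda>y. \<bar>G (x, y) * r y\<bar>)"
          using le' by (intro Bochner_Integration.integrable_bound[OF integrable_mult_right[OF r_int, of ?N]])
            (auto elim!: eventually_mono intro: order_trans[OF _ abs_ge_self])
      qed (use r_int le' in auto)
      finally show "\<bar>F x\<bar> \<le> (\<integral>y. r y \<partial>M2) * ?N" by (simp add: mult.commute)
    qed
    then show ?thesis
      using Lp_norm_le_infinity_iff[OF M10, of "(\<integral>y. r y \<partial>M2) * ?N" F] True N0 r0 by auto
  next
    case False
    let ?p = "enn2real p"
    have p1: "1 \<le> ?p" using p False by (rule enn2real_ge_1)
    have Gp: "integrable (M1 \<Otimes>\<^sub>M M2) (\<lambda>z. \<bar>G z\<bar> powr ?p)"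
      and Gle: "(\<integral>z. \<bar>G z\<bar> powr ?p \<partial>(M1 \<Otimes>\<^sub>M M2)) \<le> ?N powr ?p"
      using Lp_norm_le_finite_iff[OF p False N0, of "M1 \<Otimes>\<^sub>M M2" G] G by auto
    have Gi: "integrable (M1 \<Otimes>\<^sub>M M2) G" using p G by (rule P.in_Lp_integrable)
    have bound: "AE x in M1. \<bar>F x\<bar> powr ?p \<le> R powr ?p * (\<integral>y. \<bar>G (x, y)\<bar> powr ?p \<partial>M2)"
      using P.AE_integrable_fst'[OF Gp] P.AE_integrable_fst'[OF Gi]
    proof eventually_elim
      case (elim x)
      have int_abs: "integrable M2 (\<lambda>y. \<bar>G (x, y)\<bar>)" using elim by auto
      have [measurable]: "(\<lambda>y. G (x, y)) \<in> borel_measurable M2" using elim by auto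
      have le: "AE y in M2. \<bar>G (x, y) * r y\<bar> \<le> R * \<bar>G (x, y)\<bar>"
        using R by eventually_elim (auto simp: abs_mult mult.commute intro!: mult_right_mono)
      have "\<bar>F x\<bar> \<le> (\<integral>y. \<bar>G (x, y) * r y\<bar> \<partial>M2)"
        unfolding F_def by (rule integral_abs_bound)
      also have "\<dots> \<le> (\<integral>y. R * \<bar>G (x, y)\<bar> \<partial>M2)"
      proof (rule integral_mono_AE)
        show "integrable M2 (\<lambda>y. \<bar>G (x, y) * r y\<bar>)"
          using le by (intro Bochner_Integration.integrable_bound[OF integrable_mult_right[OF int_abs, of R]])
            (auto elim!: eventually_mono intro: order_trans[OF _ abs_ge_self])
      qed (use int_abs le in auto)
      finally have "\<bar>F x\<bar> powr ?p \<le> (R * (\<integral>y. \<bar>G (x, y)\<bar> \<partial>M2)) powr ?p"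
        using p1 by (intro powr_mono2) auto
      also have "\<dots> = R powr ?p * \<bar>\<integral>y. \<bar>G (x, y)\<bar> \<partial>M2\<bar> powr ?p"
        using R0 by (simp add: powr_mult)
      also have "\<dots> \<le> R powr ?p * (\<integral>y. \<bar>\<bar>G (x, y)\<bar>\<bar> powr ?p \<partial>M2)"
        using elim p1 int_abs
        by (intro mult_left_mono M2.jensens_inequality[where I = UNIV] convex_on_abs_powr) auto
      finally show ?case by simp
    qed
    have U: "integrable M1 (\<lambda>x. R powr ?p * (\<integral>y. \<bar>G (x, y)\<bar> powr ?p \<partial>M2))"
      using P.integrable_fst'[OF Gp] by (intro integrable_mult_right)
    have int: "integrable M1 (\<lambda>x. \<bar>F x\<bar> powr ?p)"
      using bound by (intro Bochner_Integration.integrable_bound[OF U])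
        (auto elim!: eventually_mono intro: order_trans[OF _ abs_ge_self])
    have "(\<integral>x. \<bar>F x\<bar> powr ?p \<partial>M1) \<le> (\<integral>x. R powr ?p * (\<integral>y. \<bar>G (x, y)\<bar> powr ?p \<partial>M2) \<partial>M1)"
      using int U bound by (rule integral_mono_AE)
    also have "\<dots> = R powr ?p * (\<integral>z. \<bar>G z\<bar> powr ?p \<partial>(M1 \<Otimes>\<^sub>M M2))"
      using P.integral_fst'[OF Gp] by simp
    also have "\<dots> \<le> R powr ?p * ?N powr ?p"
      using Gle by (intro mult_left_mono) auto
    also have "\<dots> = (R * ?N) powr ?p" using R0 N0 by (simp add: powr_mult)
    finally show ?thesis
      using Lp_norm_le_finite_iff[OF p False, of "R * ?N" M1 F] int R0 N0 False by auto
  qed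
qed

lemma in_Lp_distr:
  assumes [measurable]: "T \<in> M \<rightarrow>\<^sub>M N" and "g \<in> borel_measurable N"
  shows "in_Lp p M (\<lambda>x. g (T x)) \<longleftrightarrow> in_Lp p (distr M N T) g"
proof -
  note [measurable] = assms(2)
  have "(AE x in distr M N T. \<bar>g x\<bar> \<le> C) \<longleftrightarrow> (AE x in M. \<bar>g (T x)\<bar> \<le> C)" for C
    by (rule AE_distr_iff) measurable
  moreover have "integrable (distr M N T) (\<lambda>x. \<bar>g x\<bar> powr q) \<longleftrightarrow> integrable M (\<lambda>x. \<bar>g (T x)\<bar> powr q)" for q
    by (rule integrable_distr_eq) auto
  ultimately show ?thesis by (simp add: in_Lp_def)
qed

lemma Lp_norm_distr:
  assumes [measurable]: "T \<in> M \<rightarrow>\<^sub>M N" and "g \<in> borel_measurable N"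
  shows "Lp_norm p M (\<lambda>x. g (T x)) = Lp_norm p (distr M N T) g"
proof -
  note [measurable] = assms(2)
  have "(AE x in distr M N T. ereal \<bar>g x\<bar> \<le> z) \<longleftrightarrow> (AE x in M. ereal \<bar>g (T x)\<bar> \<le> z)" for z
    by (rule AE_distr_iff) measurable
  then have "esssup (distr M N T) (\<lambda>x. ereal \<bar>g x\<bar>) = esssup M (\<lambda>x. ereal \<bar>g (T x)\<bar>)"
    by (simp add: esssup_eq_AE)
  moreover have "(\<integral>x. \<bar>g x\<bar> powr q \<partial>distr M N T) = (\<integral>x. \<bar>g (T x)\<bar> powr q \<partial>M)" for q
    by (rule integral_distr) auto
  ultimately show ?thesis by (simp add: Lp_norm_def)
qed

text \<open>
  \<open>\<rho>\<close> plays the role of \<open>psibar / \<psi>\<close> and \<open>M\<close> that of the measure with Lebesgue density \<open>\<psi>\<close>;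
  two kernels with respect to \<open>M\<close> that differ by \<open>\<rho>\<close> induce the same sums of spaces.
\<close>

locale kernel_prob = prob_space M for M :: "'a measure" +
  fixes \<rho> :: "'a \<Rightarrow> real" and \<kappa> :: real
  assumes rho_measurable[measurable]: "\<rho> \<in> borel_measurable M"
    and rho_bounds: "AE t in M. 0 \<le> \<rho> t \<and> \<rho> t \<le> \<kappa>"
begin

sublocale P: product_sigma_finite "\<lambda>_::nat. M"
  by standard

abbreviation PM :: "nat set \<Rightarrow> (nat \<Rightarrow> 'a) measure" where
  "PM u \<equiv> Pi\<^sub>M u (\<lambda>_. M)"

text \<open>The factor by which integrating out one coordinate against \<open>\<rho>\<close> may
  enlarge the norm. For 1 < p < infinity it is merely an upper bound, which is enough for uniform
  boundedness.\<close>

definition rate :: "ennreal \<Rightarrow> real" where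
  "rate p = (if p = \<infinity> then \<integral>t. \<rho> t \<partial>M else \<kappa>)"

definition avg :: "nat set \<Rightarrow> nat set \<Rightarrow> ((nat \<Rightarrow> 'a) \<Rightarrow> real) \<Rightarrow> (nat \<Rightarrow> 'a) \<Rightarrow> real" where
  "avg v w g x = (\<integral>y. g (merge v w (x, y)) * (\<Prod>j\<in>w. \<rho> (y j)) \<partial>PM w)"

text \<open>The operator T with the density moved from the kernel into the measure: \<open>k\<close>
  stands for the original kernel divided by the density of \<open>M\<close>. Fubini's and Jensen's
  theorems can then be used on probability spaces.\<close>

definition Tk :: "('x \<Rightarrow> 'a \<Rightarrow> real) \<Rightarrow> nat set \<Rightarrow> ((nat \<Rightarrow> 'a) \<Rightarrow> real) \<Rightarrow> (nat \<Rightarrow> 'x) \<Rightarrow> real" where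
  "Tk k u g x = (\<integral>t. g t * (\<Prod>j\<in>u. k (x j) (t j)) \<partial>PM u)"

text \<open>The sign \<open>\<sigma>\<close> relates the two kernels by b = a +
  \<open>\<sigma>\<close> \<open>\<rho>\<close>. With respect to inclusion of index sets the map is
  triangular with the identity on the diagonal, hence injective up to null sets.\<close>

definition switch :: "real \<Rightarrow> nat set \<Rightarrow> (nat set \<Rightarrow> (nat \<Rightarrow> 'a) \<Rightarrow> real) \<Rightarrow> nat set \<Rightarrow> (nat \<Rightarrow> 'a) \<Rightarrow> real" where
  "switch \<sigma> N g v = (\<lambda>t. \<Sum>w\<in>Pow (N - v). \<sigma> ^ card w * avg v w (g (v \<union> w)) t)"

lemma prob_space_PM: "prob_space (PM u)"
  by (rule prob_space_PiM) (rule prob_space_axioms)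

lemma PM_nonzero: "emeasure (PM u) (space (PM u)) \<noteq> 0"
  using prob_space.emeasure_space_1[OF prob_space_PM] by simp

lemma kappa_nonneg: "0 \<le> \<kappa>"
proof -
  have "AE t in M. 0 \<le> \<kappa>" using rho_bounds by eventually_elim auto
  then show ?thesis by simp
qed

lemma integrable_rho: "integrable M \<rho>"
  using rho_bounds by (intro integrable_const_bound[of _ \<kappa>]) auto

lemma rate_nonneg: "0 \<le> rate p"
  using kappa_nonneg rho_bounds by (auto simp: rate_def intro!: integral_nonneg_AE)

lemma AE_PM_all:
  assumes "finite u" "\<And>j. j \<in> u \<Longrightarrow> AE t in M. Q j t"
  shows "AE t in PM u. \<forall>j\<in>u. Q j (t j)"
  using assms prob_space_axioms by (intro AE_finite_allI) (auto intro!: AE_PiM_component)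

lemma prod_rho_bounds:
  assumes "finite w"
  shows "AE y in PM w. 0 \<le> (\<Prod>j\<in>w. \<rho> (y j)) \<and> (\<Prod>j\<in>w. \<rho> (y j)) \<le> \<kappa> ^ card w"
proof -
  have "AE y in PM w. \<forall>j\<in>w. 0 \<le> \<rho> (y j) \<and> \<rho> (y j) \<le> \<kappa>"
    using assms rho_bounds by (rule AE_PM_all)
  then show ?thesis
  proof eventually_elim
    case (elim y)
    then have "(\<Prod>j\<in>w. \<rho> (y j)) \<le> (\<Prod>j\<in>w. \<kappa>)" by (intro prod_mono) auto
    with elim show ?case by (auto intro!: prod_nonneg)
  qed
qed

text \<open>Merging coordinates carries the product of \<open>PM v\<close> and \<open>PM w\<close>
  to \<open>PM (v \<union> w)\<close>, so \<open>Lp_integral_against_bounded\<close> applies with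
  the product of the \<open>\<rho> (y j)\<close> as bounded factor. Both the bound and the integral
  of this factor are powers with exponent \<open>card w\<close>.\<close>

lemma
  assumes vw: "v \<inter> w = {}" "finite v" "finite w" and p: "1 \<le> p" and g: "in_Lp p (PM (v \<union> w)) g"
  shows in_Lp_avg: "in_Lp p (PM v) (avg v w g)"
    and Lp_norm_avg_le: "Lp_norm p (PM v) (avg v w g) \<le> rate p ^ card w * Lp_norm p (PM (v \<union> w)) g"
proof -
  let ?r = "\<lambda>y. \<Prod>j\<in>w. \<rho> (y j)"
  let ?G = "\<lambda>z. g (merge v w z)"
  note gm = in_Lp_measurable[OF g]
  note distr = P.distr_merge[OF vw]
  have G: "in_Lp p (PM v \<Otimes>\<^sub>M PM w) ?G"
    using g distr in_Lp_distr[OF measurable_merge gm, of p] by simp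
  have N: "Lp_norm p (PM v \<Otimes>\<^sub>M PM w) ?G = Lp_norm p (PM (v \<union> w)) g"
    using distr Lp_norm_distr[OF measurable_merge gm, of p] by simp
  have "(\<integral>y. ?r y \<partial>PM w) = (\<integral>t. \<rho> t \<partial>M) ^ card w"
    using vw integrable_rho by (subst P.product_integral_prod) auto
  then have c: "(if p = \<infinity> then \<integral>y. ?r y \<partial>PM w else \<kappa> ^ card w) = rate p ^ card w"
    by (simp add: rate_def)
  have "in_Lp p (PM v) (avg v w g) \<and>
      Lp_norm p (PM v) (avg v w g) \<le> rate p ^ card w * Lp_norm p (PM (v \<union> w)) g"
    using Lp_integral_against_bounded[OF prob_space_PM prob_space_PM p G _ prod_rho_bounds[OF vw(3)]]
    unfolding avg_def[abs_def] N c by (simp add: borel_measurable_prod)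
  then show "in_Lp p (PM v) (avg v w g)"
    and "Lp_norm p (PM v) (avg v w g) \<le> rate p ^ card w * Lp_norm p (PM (v \<union> w)) g" by auto
qed

lemma in_Lp_switch:
  assumes N: "finite N" and v: "v \<in> Pow N" and p: "1 \<le> p"
    and g: "\<And>u. u \<in> Pow N \<Longrightarrow> in_Lp p (PM u) (g u)"
  shows "in_Lp p (PM v) (switch \<sigma> N g v)"
  unfolding switch_def
proof (intro in_Lp_sum[OF PM_nonzero p] in_Lp_cmult in_Lp_avg p)
  fix w assume w: "w \<in> Pow (N - v)"
  with v show "v \<inter> w = {}" by auto
  from w v show "finite v" "finite w" using N by (auto intro: finite_subset)
  from w v show "in_Lp p (PM (v \<union> w)) (g (v \<union> w))" by (intro g) auto
qed (use N in auto)

lemma Lp_norm_switch_le: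
  assumes N: "finite N" and v: "v \<in> Pow N" and p: "1 \<le> p" and \<sigma>: "\<bar>\<sigma>\<bar> = 1"
    and g: "\<And>u. u \<in> Pow N \<Longrightarrow> in_Lp p (PM u) (g u)"
  shows "Lp_norm p (PM v) (switch \<sigma> N g v)
    \<le> (\<Sum>w\<in>Pow (N - v). rate p ^ card w * Lp_norm p (PM (v \<union> w)) (g (v \<union> w)))"
proof -
  have w: "v \<inter> w = {}" "finite v" "finite w" "in_Lp p (PM (v \<union> w)) (g (v \<union> w))"
    if "w \<in> Pow (N - v)" for w
    using that v N g[of "v \<union> w"] by (auto intro: finite_subset)
  have "Lp_norm p (PM v) (switch \<sigma> N g v)
      \<le> (\<Sum>w\<in>Pow (N - v). Lp_norm p (PM v) (\<lambda>t. \<sigma> ^ card w * avg v w (g (v \<union> w)) t))"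
    unfolding switch_def using N w p by (intro Lp_norm_sum_le[OF PM_nonzero p] in_Lp_cmult in_Lp_avg) auto
  also have "\<dots> \<le> (\<Sum>w\<in>Pow (N - v). rate p ^ card w * Lp_norm p (PM (v \<union> w)) (g (v \<union> w)))"
    using w p \<sigma> by (intro sum_mono) (simp add: Lp_norm_cmult[OF PM_nonzero p] power_abs Lp_norm_avg_le)
  finally show ?thesis .
qed

lemma integrable_mult_AE_bounded:
  fixes f h :: "'c \<Rightarrow> real"
  assumes f: "integrable L f" and h: "h \<in> borel_measurable L" "AE t in L. \<bar>h t\<bar> \<le> B"
  shows "integrable L (\<lambda>t. f t * h t)"
proof (rule Bochner_Integration.integrable_bound)
  show "integrable L (\<lambda>t. B * \<bar>f t\<bar>)" using f by auto
  show "AE t in L. norm (f t * h t) \<le> norm (B * \<bar>f t\<bar>)"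
    using h(2)
  proof eventually_elim
    case (elim t)
    then have "\<bar>h t\<bar> * \<bar>f t\<bar> \<le> B * \<bar>f t\<bar>" by (intro mult_right_mono) auto
    also have "\<dots> \<le> \<bar>B * \<bar>f t\<bar>\<bar>" by (rule abs_ge_self)
    finally show ?case by (simp only: real_norm_def abs_mult mult.commute)
  qed
qed (use f h in auto)

lemma integrable_mult_prod:
  fixes g :: "(nat \<Rightarrow> 'a) \<Rightarrow> real"
  assumes u: "finite u" and g: "integrable (PM u) g"
    and a: "\<And>j. j \<in> u \<Longrightarrow> a j \<in> borel_measurable M" "\<And>j. j \<in> u \<Longrightarrow> \<exists>B. AE t in M. \<bar>a j t\<bar> \<le> B"
  shows "integrable (PM u) (\<lambda>t. g t * (\<Prod>j\<in>u. a j (t j)))"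
proof -
  obtain B where B: "\<And>j. j \<in> u \<Longrightarrow> AE t in M. \<bar>a j t\<bar> \<le> B j" using a(2) by metis
  have "AE t in PM u. \<forall>j\<in>u. \<bar>a j (t j)\<bar> \<le> B j" using u B by (rule AE_PM_all)
  then have "AE t in PM u. \<bar>\<Prod>j\<in>u. a j (t j)\<bar> \<le> (\<Prod>j\<in>u. B j)"
  proof eventually_elim
    case (elim t)
    then show ?case unfolding abs_prod by (intro prod_mono) auto
  qed
  then show ?thesis
    using a(1) g
    by (intro integrable_mult_AE_bounded borel_measurable_prod)
      (auto intro!: measurable_compose[OF measurable_component_singleton])
qed

lemma integral_avg:
  assumes vw: "v \<inter> w = {}" "finite v" "finite w" and g: "integrable (PM (v \<union> w)) g"
    and a: "\<And>j. j \<in> v \<Longrightarrow> a j \<in> borel_measurable M" "\<And>j. j \<in> v \<Longrightarrow> \<exists>B. AE t in M. \<bar>a j t\<bar> \<le> B"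
  shows "(\<integral>t. g t * ((\<Prod>j\<in>v. a j (t j)) * (\<Prod>j\<in>w. \<rho> (t j))) \<partial>PM (v \<union> w))
    = (\<integral>x. avg v w g x * (\<Prod>j\<in>v. a j (x j)) \<partial>PM v)"
proof -
  \<comment> \<open>Treating the factors on \<open>v\<close> and on \<open>w\<close> as a single
    family over \<open>v \<union> w\<close> lets \<open>integrable_mult_prod\<close> provide the
    integrability that Fubini's theorem needs.\<close>
  let ?a = "\<lambda>j. if j \<in> v then a j else \<rho>"
  have eq: "(\<Prod>j\<in>v \<union> w. ?a j (t j)) = (\<Prod>j\<in>v. a j (t j)) * (\<Prod>j\<in>w. \<rho> (t j))" for t
    using vw by (subst prod.union_disjoint) (auto intro!: arg_cong2[where f = "(*)"] prod.cong)
  have "AE t in M. \<bar>\<rho> t\<bar> \<le> \<kappa>" using rho_bounds by eventually_elim auto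
  then have "integrable (PM (v \<union> w)) (\<lambda>t. g t * (\<Prod>j\<in>v \<union> w. ?a j (t j)))"
    using vw g a by (intro integrable_mult_prod) auto
  then have int: "integrable (PM (v \<union> w)) (\<lambda>t. g t * ((\<Prod>j\<in>v. a j (t j)) * (\<Prod>j\<in>w. \<rho> (t j))))"
    unfolding eq .
  show ?thesis
  proof (subst P.product_integral_fold[OF vw int], intro Bochner_Integration.integral_cong refl)
    fix x
    have "(\<integral>y. g (merge v w (x, y)) * ((\<Prod>j\<in>v. a j (merge v w (x, y) j)) * (\<Prod>j\<in>w. \<rho> (merge v w (x, y) j))) \<partial>PM w)
      = (\<integral>y. (g (merge v w (x, y)) * (\<Prod>j\<in>w. \<rho> (y j))) * (\<Prod>j\<in>v. a j (x j)) \<partial>PM w)"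
      using vw(1) by (intro Bochner_Integration.integral_cong refl)
        (auto simp: mult_ac intro!: arg_cong2[where f = "(*)"] prod.cong)
    then show "(\<integral>y. g (merge v w (x, y)) * ((\<Prod>j\<in>v. a j (merge v w (x, y) j)) * (\<Prod>j\<in>w. \<rho> (merge v w (x, y) j))) \<partial>PM w)
      = avg v w g x * (\<Prod>j\<in>v. a j (x j))"
      by (simp add: avg_def)
  qed
qed

end

text \<open>Pairs w \<subseteq> u \<subseteq> N correspond to disjoint pairs (v, w) in N through v =
  u - w. This regroups expansions over \<open>u\<close> by the coordinates that survive the
  integration.\<close>

lemma sum_Pow_split:
  fixes F :: "'b set \<Rightarrow> 'b set \<Rightarrow> 'c::comm_monoid_add"
  assumes "finite N"
  shows "(\<Sum>u\<in>Pow N. \<Sum>w\<in>Pow u. F (u - w) w) = (\<Sum>v\<in>Pow N. \<Sum>w\<in>Pow (N - v). F v w)"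
proof -
  have "(\<Sum>u\<in>Pow N. \<Sum>w\<in>Pow u. F (u - w) w) = (\<Sum>(u, w)\<in>Sigma (Pow N) Pow. F (u - w) w)"
    using assms by (intro sum.Sigma) (auto intro: finite_subset)
  also have "\<dots> = (\<Sum>(v, w)\<in>Sigma (Pow N) (\<lambda>v. Pow (N - v)). F v w)"
    by (rule sum.reindex_bij_witness[of _ "\<lambda>(v, w). (v \<union> w, w)" "\<lambda>(u, w). (u - w, w)"]) auto
  also have "\<dots> = (\<Sum>v\<in>Pow N. \<Sum>w\<in>Pow (N - v). F v w)"
    using assms by (intro sum.Sigma[symmetric]) auto
  finally show ?thesis .
qed

lemma sum_Pow_power_card:
  fixes c :: "'b::comm_semiring_1"
  assumes "finite N"
  shows "(\<Sum>w\<in>Pow N. c ^ card w) = (1 + c) ^ card N"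
  using prod_add[OF assms, of "\<lambda>_. c" "\<lambda>_. 1"] by (simp add: add.commute)

section \<open>Exchanging one kernel for the other\<close>

context kernel_prob
begin

lemma Tk_sum:
  assumes u: "finite u" and I: "finite I" and g: "\<And>i. i \<in> I \<Longrightarrow> integrable (PM u) (g i)"
    and k: "\<And>j. j \<in> u \<Longrightarrow> k (x j) \<in> borel_measurable M" "\<And>j. j \<in> u \<Longrightarrow> \<exists>B. AE t in M. \<bar>k (x j) t\<bar> \<le> B"
  shows "Tk k u (\<lambda>t. \<Sum>i\<in>I. c i * g i t) x = (\<Sum>i\<in>I. c i * Tk k u (g i) x)"
proof -
  have int: "integrable (PM u) (\<lambda>t. g i t * (\<Prod>j\<in>u. k (x j) (t j)))" if "i \<in> I" for i
    using u g[OF that] k by (rule integrable_mult_prod)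
  have "Tk k u (\<lambda>t. \<Sum>i\<in>I. c i * g i t) x
      = (\<integral>t. (\<Sum>i\<in>I. c i * (g i t * (\<Prod>j\<in>u. k (x j) (t j)))) \<partial>PM u)"
    unfolding Tk_def by (simp add: sum_distrib_right mult.assoc)
  also have "\<dots> = (\<Sum>i\<in>I. c i * Tk k u (g i) x)"
    unfolding Tk_def using int by (subst Bochner_Integration.integral_sum) auto
  finally show ?thesis .
qed

lemma integrable_avg:
  assumes "v \<inter> w = {}" "finite v" "finite w" "in_Lp p (PM (v \<union> w)) g" "1 \<le> p"
  shows "integrable (PM v) (avg v w g)"
  using assms by (intro prob_space.in_Lp_integrable[OF prob_space_PM] in_Lp_avg)

text \<open>Multiplying out the product of the sums a + \<open>\<sigma>\<close>
  \<open>\<rho>\<close>, let \<open>w\<close> be the set of coordinates where the second summand is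
  chosen. In that term the coordinates in \<open>w\<close> no longer interact with \<open>x\<close>,
  and \<open>integral_avg\<close> integrates them out.\<close>

lemma Tk_switch_kernel:
  assumes u: "finite u" and p: "1 \<le> p" and g: "in_Lp p (PM u) g"
    and a: "\<And>j. j \<in> u \<Longrightarrow> a (x j) \<in> borel_measurable M" "\<And>j. j \<in> u \<Longrightarrow> \<exists>B. AE t in M. \<bar>a (x j) t\<bar> \<le> B"
    and b: "\<And>j t. j \<in> u \<Longrightarrow> b (x j) t = a (x j) t + \<sigma> * \<rho> t"
  shows "Tk b u g x = (\<Sum>w\<in>Pow u. \<sigma> ^ card w * Tk a (u - w) (avg (u - w) w g) x)"
proof -
  have gi: "integrable (PM u) g" using p g by (rule prob_space.in_Lp_integrable[OF prob_space_PM])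
  have summand: "integrable (PM u) (\<lambda>t. g t * ((\<Prod>j\<in>u - w. a (x j) (t j)) * (\<Prod>j\<in>w. \<rho> (t j))))"
    "(\<integral>t. g t * ((\<Prod>j\<in>u - w. a (x j) (t j)) * (\<Prod>j\<in>w. \<rho> (t j))) \<partial>PM u)
      = Tk a (u - w) (avg (u - w) w g) x" if "w \<in> Pow u" for w
  proof -
    from that have w: "(u - w) \<inter> w = {}" "finite (u - w)" "finite w" "u - w \<union> w = u" "w \<subseteq> u"
      using u by (auto intro: finite_subset)
    have eq: "(\<Prod>j\<in>u. (if j \<in> w then \<rho> else a (x j)) (t j))
        = (\<Prod>j\<in>u - w. a (x j) (t j)) * (\<Prod>j\<in>w. \<rho> (t j))" for t
      using u w by (subst prod.subset_diff[of w u]) (auto intro!: arg_cong2[where f = "(*)"] prod.cong)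
    have "AE t in M. \<bar>\<rho> t\<bar> \<le> \<kappa>" using rho_bounds by eventually_elim auto
    then have "integrable (PM u) (\<lambda>t. g t * (\<Prod>j\<in>u. (if j \<in> w then \<rho> else a (x j)) (t j)))"
      using u gi a by (intro integrable_mult_prod) auto
    then show "integrable (PM u) (\<lambda>t. g t * ((\<Prod>j\<in>u - w. a (x j) (t j)) * (\<Prod>j\<in>w. \<rho> (t j))))"
      unfolding eq .
    show "(\<integral>t. g t * ((\<Prod>j\<in>u - w. a (x j) (t j)) * (\<Prod>j\<in>w. \<rho> (t j))) \<partial>PM u)
      = Tk a (u - w) (avg (u - w) w g) x"
      using integral_avg[OF w(1-3), of g "\<lambda>j. a (x j)"] a gi w(4) by (simp add: Tk_def)
  qed
  have expand: "(\<Prod>j\<in>u. b (x j) (t j))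
      = (\<Sum>w\<in>Pow u. \<sigma> ^ card w * ((\<Prod>j\<in>u - w. a (x j) (t j)) * (\<Prod>j\<in>w. \<rho> (t j))))" for t
  proof -
    have "(\<Prod>j\<in>u. b (x j) (t j)) = (\<Prod>j\<in>u. \<sigma> * \<rho> (t j) + a (x j) (t j))"
      using b by (intro prod.cong) auto
    also have "\<dots> = (\<Sum>w\<in>Pow u. (\<Prod>j\<in>w. \<sigma> * \<rho> (t j)) * (\<Prod>j\<in>u - w. a (x j) (t j)))"
      by (rule prod_add[OF u])
    finally show ?thesis by (simp add: prod.distrib mult_ac)
  qed
  have "Tk b u g x = (\<integral>t. (\<Sum>w\<in>Pow u. \<sigma> ^ card w *
      (g t * ((\<Prod>j\<in>u - w. a (x j) (t j)) * (\<Prod>j\<in>w. \<rho> (t j))))) \<partial>PM u)"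
    unfolding Tk_def expand by (simp add: sum_distrib_left mult_ac)
  also have "\<dots> = (\<Sum>w\<in>Pow u. \<sigma> ^ card w * Tk a (u - w) (avg (u - w) w g) x)"
    using summand by (subst Bochner_Integration.integral_sum) auto
  finally show ?thesis .
qed

lemma sum_Tk_switch:
  assumes N: "finite N" and p: "1 \<le> p" and g: "\<And>u. u \<in> Pow N \<Longrightarrow> in_Lp p (PM u) (g u)"
    and a: "\<And>j. j \<in> N \<Longrightarrow> a (x j) \<in> borel_measurable M" "\<And>j. j \<in> N \<Longrightarrow> \<exists>B. AE t in M. \<bar>a (x j) t\<bar> \<le> B"
    and b: "\<And>j t. j \<in> N \<Longrightarrow> b (x j) t = a (x j) t + \<sigma> * \<rho> t"
  shows "(\<Sum>u\<in>Pow N. Tk b u (g u) x) = (\<Sum>v\<in>Pow N. Tk a v (switch \<sigma> N g v) x)"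
proof -
  have "(\<Sum>u\<in>Pow N. Tk b u (g u) x)
      = (\<Sum>u\<in>Pow N. \<Sum>w\<in>Pow u. \<sigma> ^ card w * Tk a (u - w) (avg (u - w) w (g u)) x)"
    using assms by (intro sum.cong refl Tk_switch_kernel[OF _ p]) (auto intro: finite_subset)
  \<comment> \<open>Writing \<open>u\<close> as \<open>u - w \<union> w\<close> makes the summand a
    function of \<open>u - w\<close> and \<open>w\<close> only, the form required by
    \<open>sum_Pow_split\<close>.\<close>
  also have "\<dots> = (\<Sum>u\<in>Pow N. \<Sum>w\<in>Pow u. \<sigma> ^ card w * Tk a (u - w) (avg (u - w) w (g (u - w \<union> w))) x)"
    by (intro sum.cong refl) (auto simp: Un_absorb2)
  also have "\<dots> = (\<Sum>v\<in>Pow N. \<Sum>w\<in>Pow (N - v). \<sigma> ^ card w * Tk a v (avg v w (g (v \<union> w))) x)"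
    by (rule sum_Pow_split[OF N])
  also have "\<dots> = (\<Sum>v\<in>Pow N. Tk a v (switch \<sigma> N g v) x)"
  proof (intro sum.cong refl)
    fix v assume v: "v \<in> Pow N"
    then have w: "v \<inter> w = {}" "finite v" "finite w" "in_Lp p (PM (v \<union> w)) (g (v \<union> w))"
      if "w \<in> Pow (N - v)" for w
      using that N g[of "v \<union> w"] by (auto intro: finite_subset)
    show "(\<Sum>w\<in>Pow (N - v). \<sigma> ^ card w * Tk a v (avg v w (g (v \<union> w))) x) = Tk a v (switch \<sigma> N g v) x"
      unfolding switch_def using w v a N
      by (intro Tk_sum[symmetric, where g = "\<lambda>w. avg v w (g (v \<union> w))"] integrable_avg[OF _ _ _ _ p])
        (auto intro: finite_subset)
  qed
  finally show ?thesis .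
qed

lemma avg_AE_zero:
  assumes vw: "v \<inter> w = {}" "finite v" "finite w"
    and z: "AE t in PM (v \<union> w). g t = 0"
  shows "AE x in PM v. avg v w g x = 0"
proof -
  note distr = P.distr_merge[OF vw]
  interpret v: prob_space "PM v" by (rule prob_space_PM)
  interpret w: prob_space "PM w" by (rule prob_space_PM)
  interpret vw: pair_prob_space "PM v" "PM w" ..
  have "AE t in distr (PM v \<Otimes>\<^sub>M PM w) (PM (v \<union> w)) (merge v w). g t = 0"
    unfolding distr by (rule z)
  then have "AE z in PM v \<Otimes>\<^sub>M PM w. g (merge v w z) = 0"
    by (rule AE_distrD[OF measurable_merge])
  from vw.AE_pair[OF this] show ?thesis
    by eventually_elim (auto simp: avg_def intro!: integral_eq_zero_AE)
qed

text \<open>The term \<open>w = {}\<close> of \<open>switch\<close> is \<open>g v\<close>, and the others only involve larger index sets.\<close>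

lemma switch_AE_zero:
  assumes N: "finite N" and g: "\<And>u. u \<in> Pow N \<Longrightarrow> g u \<in> borel_measurable (PM u)"
    and z: "\<And>v. v \<in> Pow N \<Longrightarrow> AE t in PM v. switch \<sigma> N g v t = 0"
    and v: "v \<in> Pow N"
  shows "AE t in PM v. g v t = 0"
  using v
\<comment> \<open>The induction descends from \<open>v = N\<close>: at \<open>v\<close>, all
  strictly larger index sets are already settled.\<close>
proof (induction "card (N - v)" arbitrary: v rule: less_induct)
  case less
  then have v: "v \<subseteq> N" "finite v" using N by (auto intro: finite_subset)
  have "AE t in PM v. avg v w (g (v \<union> w)) t = 0" if "w \<in> Pow (N - v) - {{}}" for w
  proof (rule avg_AE_zero)
    show "AE t in PM (v \<union> w). g (v \<union> w) t = 0"
      using that v N by (intro less.hyps psubset_card_mono) auto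
  qed (use that v N in \<open>auto intro: finite_subset\<close>)
  then have "AE t in PM v. \<forall>w\<in>Pow (N - v) - {{}}. avg v w (g (v \<union> w)) t = 0"
    using N by (intro AE_finite_allI) auto
  with z[OF less.prems] AE_space show ?case
  proof eventually_elim
    case (elim t)
    have "switch \<sigma> N g v t = avg v {} (g v) t
        + (\<Sum>w\<in>Pow (N - v) - {{}}. \<sigma> ^ card w * avg v w (g (v \<union> w)) t)"
      unfolding switch_def using N by (subst sum.remove[of _ "{}"]) auto
    \<comment> \<open>The space of \<open>PM {}\<close> has the single point
      \<open>\<lambda>_. undefined\<close>. Merging with it returns \<open>t\<close> because points
      of \<open>PM v\<close> are undefined outside \<open>v\<close>.\<close>
    moreover have "merge v {} (t, \<lambda>_. undefined) = t"
      using elim by (auto simp: merge_def fun_eq_iff space_PiM PiE_def extensional_def)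
    then have "avg v {} (g v) t = g v t"
      by (simp add: avg_def PiM_empty lebesgue_integral_count_space_finite)
    ultimately show ?case using elim by simp
  qed
qed

end

section \<open>Injectivity on product spaces\<close>

context kernel_prob
begin

text \<open>Integrating out all coordinates except \<open>j\<close> leaves a function
  \<open>H\<close> of one variable that does not depend on the factor \<open>a\<close>. A property
  tested with some choices of \<open>a\<close> can thus be transferred to all others.\<close>

lemma split_off_coordinate:
  fixes g :: "(nat \<Rightarrow> 'a) \<Rightarrow> real"
  assumes u: "finite u" "j \<notin> u" and g: "integrable (PM (insert j u)) g"
    and b: "\<And>i. i \<in> u \<Longrightarrow> b i \<in> borel_measurable M" "\<And>i. i \<in> u \<Longrightarrow> \<exists>B. AE t in M. \<bar>b i t\<bar> \<le> B"
  obtains H where "integrable M H"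
    "\<And>a B. a \<in> borel_measurable M \<Longrightarrow> AE t in M. \<bar>a t\<bar> \<le> B \<Longrightarrow>
      (\<integral>t. g t * (a (t j) * (\<Prod>i\<in>u. b i (t i))) \<partial>PM (insert j u)) = (\<integral>s. H s * a s \<partial>M)"
proof -
  interpret j: prob_space "PM {j}" by (rule prob_space_PM)
  interpret u: prob_space "PM u" by (rule prob_space_PM)
  interpret ju: pair_prob_space "PM {j}" "PM u" ..
  have ju: "{j} \<inter> u = {}" "finite {j}" "finite u" using u by auto
  have ins: "{j} \<union> u = insert j u" by auto
  let ?\<phi> = "\<lambda>x. \<integral>y. g (merge {j} u (x, y)) * (\<Prod>i\<in>u. b i (y i)) \<partial>PM u"
  \<comment> \<open>\<open>PM {j}\<close> consists of functions on a one-point index set;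
    \<open>?c\<close> is the embedding of the real-valued or abstract variable \<open>s\<close> that
    carries \<open>M\<close> to it.\<close>
  let ?c = "\<lambda>s::'a. \<lambda>i\<in>{j}. s"
  define H where "H = (\<lambda>s. ?\<phi> (?c s))"
  have int: "integrable (PM (insert j u)) (\<lambda>t. g t * (a (t j) * (\<Prod>i\<in>u. b i (t i))))"
    if a: "a \<in> borel_measurable M" "AE t in M. \<bar>a t\<bar> \<le> B" for a B
  proof -
    have eq: "(\<Prod>i\<in>insert j u. (if i = j then a else b i) (t i)) = a (t j) * (\<Prod>i\<in>u. b i (t i))" for t
      using u by (auto intro!: arg_cong2[where f = "(*)"] prod.cong)
    have "integrable (PM (insert j u)) (\<lambda>t. g t * (\<Prod>i\<in>insert j u. (if i = j then a else b i) (t i)))"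
      using u g b a by (intro integrable_mult_prod) auto
    then show ?thesis unfolding eq .
  qed
  have eq: "(\<lambda>z. g (merge {j} u z) * (\<Prod>i\<in>u. b i (merge {j} u z i))) =
      (\<lambda>z. g (merge {j} u z) * (\<Prod>i\<in>u. b i (snd z i)))"
    using u by (auto simp: fun_eq_iff merge_def intro!: arg_cong2[where f = "(*)"] prod.cong)
  have "integrable (PM (insert j u)) (\<lambda>t. g t * (\<Prod>i\<in>u. b i (t i)))"
    using int[of "\<lambda>_. 1" 1] by simp
  then have "integrable (PM {j} \<Otimes>\<^sub>M PM u) (\<lambda>z. g (merge {j} u z) * (\<Prod>i\<in>u. b i (merge {j} u z i)))"
    using P.distr_merge[OF ju] integrable_distr[OF measurable_merge[of "{j}" u "\<lambda>_. M"],
        of "\<lambda>t. g t * (\<Prod>i\<in>u. b i (t i))"]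
    by (simp add: ins)
  then have "integrable (PM {j} \<Otimes>\<^sub>M PM u) (\<lambda>z. g (merge {j} u z) * (\<Prod>i\<in>u. b i (snd z i)))"
    unfolding eq .
  from ju.integrable_fst'[OF this] have \<phi>: "integrable (PM {j}) ?\<phi>" by simp
  have c: "?c \<in> M \<rightarrow>\<^sub>M PM {j}" by measurable
  note distr_c = P.distr_component[of j]
  have "integrable M H"
    unfolding H_def using \<phi> distr_c by (intro integrable_distr[OF c]) simp
  moreover have "(\<integral>t. g t * (a (t j) * (\<Prod>i\<in>u. b i (t i))) \<partial>PM (insert j u)) = (\<integral>s. H s * a s \<partial>M)"
    if a: "a \<in> borel_measurable M" "AE t in M. \<bar>a t\<bar> \<le> B" for a B
  proof -
    have int': "integrable (PM ({j} \<union> u)) (\<lambda>t. g t * (a (t j) * (\<Prod>i\<in>u. b i (t i))))"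
      using int[OF a] by (simp add: ins)
    have "(\<integral>t. g t * (a (t j) * (\<Prod>i\<in>u. b i (t i))) \<partial>PM ({j} \<union> u))
      = (\<integral>x. (\<integral>y. g (merge {j} u (x, y)) * (a (merge {j} u (x, y) j) *
          (\<Prod>i\<in>u. b i (merge {j} u (x, y) i))) \<partial>PM u) \<partial>PM {j})"
      by (rule P.product_integral_fold[OF ju int'])
    also have "\<dots> = (\<integral>x. ?\<phi> x * a (x j) \<partial>PM {j})"
    proof (intro Bochner_Integration.integral_cong refl)
      fix x
      have "(\<integral>y. g (merge {j} u (x, y)) * (a (merge {j} u (x, y) j) *
          (\<Prod>i\<in>u. b i (merge {j} u (x, y) i))) \<partial>PM u)
        = (\<integral>y. (g (merge {j} u (x, y)) * (\<Prod>i\<in>u. b i (y i))) * a (x j) \<partial>PM u)"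
        using ju(1) by (intro Bochner_Integration.integral_cong refl)
          (auto simp: mult_ac intro!: arg_cong2[where f = "(*)"] prod.cong)
      then show "(\<integral>y. g (merge {j} u (x, y)) * (a (merge {j} u (x, y) j) *
          (\<Prod>i\<in>u. b i (merge {j} u (x, y) i))) \<partial>PM u) = ?\<phi> x * a (x j)"
        by simp
    qed
    also have "\<dots> = (\<integral>x. ?\<phi> x * a (x j) \<partial>distr M (PM {j}) ?c)"
      by (simp add: distr_c)
    also have "\<dots> = (\<integral>s. H s * a s \<partial>M)"
      unfolding H_def using \<phi> a(1)
      by (subst integral_distr[OF c]) (auto intro!: measurable_compose[OF measurable_component_singleton])
    finally show ?thesis by (simp add: ins)
  qed
  ultimately show ?thesis by (rule that)
qed

text \<open>The kernels are replaced by indicators of arbitrary measurable sets one coordinate at a time.\<close>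

lemma Tk_injective:
  fixes g :: "(nat \<Rightarrow> 'a) \<Rightarrow> real"
  assumes u: "finite u" and g: "integrable (PM u) g"
    and k: "\<And>x. x \<in> X \<Longrightarrow> k x \<in> borel_measurable M" "\<And>x. x \<in> X \<Longrightarrow> \<exists>B. AE t in M. \<bar>k x t\<bar> \<le> B"
    and separating: "\<And>H. integrable M H \<Longrightarrow> (\<And>x. x \<in> X \<Longrightarrow> (\<integral>s. H s * k x s \<partial>M) = 0) \<Longrightarrow> AE s in M. H s = 0"
    and zero: "\<And>x. (\<And>j. j \<in> u \<Longrightarrow> x j \<in> X) \<Longrightarrow> Tk k u g x = 0"
  shows "AE t in PM u. g t = 0"
proof -
  \<comment> \<open>The coordinates in \<open>w\<close> already carry indicators, the remaining ones
    still carry kernels. The hypothesis \<open>zero\<close> is the case \<open>w = {}\<close>, and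
    the case \<open>w = u\<close> gives integrals over boxes.\<close>
  define adm where "adm w b \<longleftrightarrow> (\<forall>j\<in>w. \<exists>A\<in>sets M. b j = indicat_real A) \<and> (\<forall>j\<in>u - w. \<exists>x\<in>X. b j = k x)"
    for w b
  have step: "(\<integral>t. g t * (\<Prod>j\<in>u. b j (t j)) \<partial>PM u) = 0" if "w \<subseteq> u" "adm w b" for w b
  proof -
    from that(1) u have "finite w" by (rule finite_subset)
    then show ?thesis using that
    proof (induction w arbitrary: b rule: finite_induct)
      case empty
      then have "\<forall>j\<in>u. \<exists>x\<in>X. b j = k x" by (simp add: adm_def)
      then obtain x where x: "\<And>j. j \<in> u \<Longrightarrow> x j \<in> X" "\<And>j. j \<in> u \<Longrightarrow> b j = k (x j)" by metis
      from zero[of x] x show ?case by (simp add: Tk_def)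
    next
      case (insert j w)
      define u' where "u' = u - {j}"
      have u': "finite u'" "j \<notin> u'" "u = insert j u'" using u insert.prems by (auto simp: u'_def)
      have b: "b i \<in> borel_measurable M \<and> (\<exists>B. AE t in M. \<bar>b i t\<bar> \<le> B)" if "i \<in> u" for i
      proof (cases "i \<in> insert j w")
        case True
        then obtain A where A: "A \<in> sets M" "b i = indicat_real A"
          using insert.prems(2) by (auto simp: adm_def)
        have "AE t in M. \<bar>indicat_real A t\<bar> \<le> 1" by (auto simp: indicator_def)
        with A show ?thesis by auto
      next
        case False
        with that insert.prems(2) obtain x where "x \<in> X" "b i = k x" by (auto simp: adm_def)
        with k show ?thesis by auto
      qed
      obtain H where H: "integrable M H"
        and split: "\<And>a B. a \<in> borel_measurable M \<Longrightarrow> AE t in M. \<bar>a t\<bar> \<le> B \<Longrightarrow>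
          (\<integral>t. g t * (a (t j) * (\<Prod>i\<in>u'. b i (t i))) \<partial>PM (insert j u')) = (\<integral>s. H s * a s \<partial>M)"
        using split_off_coordinate[OF u'(1,2), of g b] g u' b by auto
      \<comment> \<open>By the induction hypothesis, putting any kernel \<open>k x\<close> in
        coordinate \<open>j\<close> gives integral 0. So \<open>H\<close> is orthogonal to all
        kernels and vanishes, after which the indicator \<open>b j\<close> may take their
        place.\<close>
      have "AE s in M. H s = 0"
      proof (rule separating[OF H])
        fix x assume x: "x \<in> X"
        have "adm w (b(j := k x))"
          using insert.prems(2) insert.hyps x by (auto simp: adm_def)
        from insert.IH[OF _ this] insert.prems(1)
        have "(\<integral>t. g t * (\<Prod>i\<in>u. (b(j := k x)) i (t i)) \<partial>PM u) = 0" by simp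
        moreover have "(\<Prod>i\<in>u. (b(j := k x)) i (t i)) = k x (t j) * (\<Prod>i\<in>u'. b i (t i))" for t
          using u' by (auto intro!: arg_cong2[where f = "(*)"] prod.cong)
        ultimately show "(\<integral>s. H s * k x s \<partial>M) = 0"
          using k[OF x] split[of "k x"] u'(3) by auto
      qed
      then have "(\<integral>s. H s * b j s \<partial>M) = 0"
        by (intro integral_eq_zero_AE) (auto elim: eventually_mono)
      moreover have "(\<Prod>i\<in>u. b i (t i)) = b j (t j) * (\<Prod>i\<in>u'. b i (t i))" for t
        using u' by simp
      moreover have "j \<in> u" using u' by simp
      ultimately show ?case
        using b[of j] split[of "b j"] u'(3) by auto
    qed
  qed
  interpret u: prob_space "PM u" by (rule prob_space_PM)
  have rect: "(LINT t:Pi\<^sub>E u A|PM u. g t) = 0" if A: "\<And>j. j \<in> u \<Longrightarrow> A j \<in> sets M" for A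
  proof -
    have "(LINT t:Pi\<^sub>E u A|PM u. g t) = (\<integral>t. g t * (\<Prod>j\<in>u. indicator (A j) (t j)) \<partial>PM u)"
      unfolding set_lebesgue_integral_def
    proof (intro Bochner_Integration.integral_cong refl)
      fix t assume "t \<in> space (PM u)"
      then have "indicat_real (Pi\<^sub>E u A) t = (\<Prod>j\<in>u. indicator (A j) (t j))"
        using u by (auto simp: indicator_def space_PiM PiE_iff)
      then show "indicat_real (Pi\<^sub>E u A) t *\<^sub>R g t = g t * (\<Prod>j\<in>u. indicator (A j) (t j))" by simp
    qed
    also have "\<dots> = 0" using A by (intro step[of u]) (auto simp: adm_def)
    finally show ?thesis .
  qed
  show ?thesis
  proof (rule u.AE_zero_if_integral_zero_on_generator[OF g])
    show "sets (PM u) = sigma_sets (space (PM u)) (prod_algebra u (\<lambda>_. M))"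
      by (simp add: sets_PiM space_PiM)
    show "Int_stable (prod_algebra u (\<lambda>_. M))" by (rule Int_stable_prod_algebra)
    show "prod_algebra u (\<lambda>_. M) \<subseteq> Pow (space (PM u))"
      using prod_algebra_sets_into_space[of u "\<lambda>_. M"] by (simp add: space_PiM)
    have "(\<integral>t. g t \<partial>PM u) = (LINT t:Pi\<^sub>E u (\<lambda>_. space M)|PM u. g t)"
      unfolding set_lebesgue_integral_def
      by (intro Bochner_Integration.integral_cong) (auto simp: space_PiM)
    then show "(\<integral>t. g t \<partial>PM u) = 0" by (simp add: rect)
    show "(LINT t:A|PM u. g t) = 0" if "A \<in> prod_algebra u (\<lambda>_. M)" for A
      using that rect by (auto simp: prod_algebra_eq_finite[OF u])
  qed
qed

section \<open>Product functions, the source of the lower bounds\<close>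

lemma in_Lp_power:
  assumes u: "finite u" and \<phi>: "in_Lp p M \<phi>"
  shows "in_Lp p (PM u) (\<lambda>t. \<Prod>j\<in>u. \<phi> (t j))"
proof (cases "p = \<infinity>")
  case True
  with \<phi> obtain B where B: "\<phi> \<in> borel_measurable M" "AE t in M. \<bar>\<phi> t\<bar> \<le> B" by (auto simp: in_Lp_def)
  from u B(2) have "AE t in PM u. \<forall>j\<in>u. \<bar>\<phi> (t j)\<bar> \<le> B" by (rule AE_PM_all)
  then have "AE t in PM u. \<bar>\<Prod>j\<in>u. \<phi> (t j)\<bar> \<le> B ^ card u"
  proof eventually_elim
    case (elim t)
    then have "(\<Prod>j\<in>u. \<bar>\<phi> (t j)\<bar>) \<le> (\<Prod>j\<in>u. B)" by (intro prod_mono) auto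
    then show ?case by (simp add: abs_prod)
  qed
  with True B(1) show ?thesis
    by (auto simp: in_Lp_def intro!: borel_measurable_prod measurable_compose[OF measurable_component_singleton])
next
  case False
  have "\<bar>\<Prod>j\<in>u. \<phi> (t j)\<bar> powr enn2real p = (\<Prod>j\<in>u. \<bar>\<phi> (t j)\<bar> powr enn2real p)" for t
    by (simp add: abs_prod prod_powr_distrib)
  with False u \<phi> show ?thesis
    by (auto simp: in_Lp_def intro!: P.product_integrable_prod borel_measurable_prod measurable_compose[OF measurable_component_singleton])
qed

text \<open>Each coordinate integrated out of a product function contributes the same number, the
  integral of \<open>\<phi>\<close> times \<open>\<rho>\<close>. On multiples of product functions
  \<open>switch\<close> therefore only acts on the coefficients.\<close>

lemma switch_power:
  assumes N: "finite N" and v: "v \<in> Pow N" and \<phi>: "integrable M (\<lambda>t. \<phi> t * \<rho> t)"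
  shows "switch \<sigma> N (\<lambda>u t. c u * (\<Prod>j\<in>u. \<phi> (t j))) v t =
    (\<Sum>w\<in>Pow (N - v). (\<sigma> * (\<integral>s. \<phi> s * \<rho> s \<partial>M)) ^ card w * c (v \<union> w)) * (\<Prod>j\<in>v. \<phi> (t j))"
proof -
  have "avg v w (\<lambda>t. c (v \<union> w) * (\<Prod>j\<in>v \<union> w. \<phi> (t j))) t
      = c (v \<union> w) * (\<Prod>j\<in>v. \<phi> (t j)) * (\<integral>s. \<phi> s * \<rho> s \<partial>M) ^ card w" if "w \<in> Pow (N - v)" for w
  proof -
    have w: "v \<inter> w = {}" "finite v" "finite w" using that v N by (auto intro: finite_subset)
    have "(\<Prod>j\<in>v \<union> w. \<phi> (merge v w (t, y) j)) = (\<Prod>j\<in>v. \<phi> (t j)) * (\<Prod>j\<in>w. \<phi> (y j))" for y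
      using w by (subst prod.union_disjoint) (auto intro!: arg_cong2[where f = "(*)"] prod.cong)
    then have "avg v w (\<lambda>t. c (v \<union> w) * (\<Prod>j\<in>v \<union> w. \<phi> (t j))) t
        = (\<integral>y. c (v \<union> w) * (\<Prod>j\<in>v. \<phi> (t j)) * (\<Prod>j\<in>w. \<phi> (y j) * \<rho> (y j)) \<partial>PM w)"
      unfolding avg_def by (intro Bochner_Integration.integral_cong refl) (simp add: prod.distrib mult_ac)
    also have "\<dots> = c (v \<union> w) * (\<Prod>j\<in>v. \<phi> (t j)) * (\<Prod>j\<in>w. \<integral>s. \<phi> s * \<rho> s \<partial>M)"
      using P.product_integral_prod[OF w(3), of "\<lambda>_ s. \<phi> s * \<rho> s"] \<phi> by simp
    finally show ?thesis by simp
  qed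
  then show ?thesis
    unfolding switch_def sum_distrib_right
    by (intro sum.cong refl) (simp add: power_mult_distrib mult_ac)
qed

end

section \<open>Weighted sequence norms\<close>

lemma Lp_norm_mono:
  assumes M: "emeasure M (space M) \<noteq> 0" and p: "1 \<le> p"
    and f: "f \<in> borel_measurable M" and g: "in_Lp p M g" and le: "AE t in M. \<bar>f t\<bar> \<le> \<bar>g t\<bar>"
  shows "Lp_norm p M f \<le> Lp_norm p M g"
proof (cases "p = \<infinity>")
  case True
  note pos = Lp_norm_nonneg[OF M, of \<infinity> g]
  have "AE t in M. \<bar>g t\<bar> \<le> Lp_norm \<infinity> M g"
    using Lp_norm_le_infinity_iff[OF M pos, of g] g True by auto
  with le have "AE t in M. \<bar>f t\<bar> \<le> Lp_norm \<infinity> M g" by eventually_elim auto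
  then show ?thesis
    using Lp_norm_le_infinity_iff[OF M pos, of f] f True by auto
next
  case False
  let ?p = "enn2real p"
  have p1: "1 \<le> ?p" using p False by (rule enn2real_ge_1)
  from le have le': "AE t in M. \<bar>f t\<bar> powr ?p \<le> \<bar>g t\<bar> powr ?p"
    using p1 by (auto elim!: eventually_mono intro!: powr_mono2)
  have gi: "integrable M (\<lambda>t. \<bar>g t\<bar> powr ?p)" using g False by (simp add: in_Lp_def)
  have "integrable M (\<lambda>t. \<bar>f t\<bar> powr ?p)"
    using f le' by (intro Bochner_Integration.integrable_bound[OF gi]) auto
  then have "(\<integral>t. \<bar>f t\<bar> powr ?p \<partial>M) \<le> (\<integral>t. \<bar>g t\<bar> powr ?p \<partial>M)"
    using gi le' by (intro integral_mono_AE)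
  then show ?thesis using False p1 by (auto simp: Lp_norm_def intro!: powr_mono2)
qed

lemma in_Lp_count_space: "finite A \<Longrightarrow> in_Lp p (count_space A) f"
  unfolding in_Lp_def
  by (auto simp: AE_count_space integrable_count_space intro!: exI[of _ "Max ((\<lambda>x. \<bar>f x\<bar>) ` A)"])

lemma Lp_norm_infinity_count_space:
  assumes A: "finite A" "A \<noteq> {}" and f: "\<And>x. x \<in> A \<Longrightarrow> 0 \<le> f x"
  shows "Lp_norm \<infinity> (count_space A) f = Max (f ` A)"
proof (rule antisym)
  have nz: "emeasure (count_space A) (space (count_space A)) \<noteq> 0"
    using A by (simp add: emeasure_count_space)
  have 0: "0 \<le> Max (f ` A)" using A f by (auto simp: Max_ge_iff)
  show "Lp_norm \<infinity> (count_space A) f \<le> Max (f ` A)"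
    using Lp_norm_le_infinity_iff[OF nz 0, of f] A f by (auto simp: AE_count_space)
  have "AE x in count_space A. \<bar>f x\<bar> \<le> Lp_norm \<infinity> (count_space A) f"
    using Lp_norm_le_infinity_iff[OF nz Lp_norm_nonneg[OF nz, of \<infinity> f], of f] in_Lp_count_space[OF A(1)] by blast
  then show "Max (f ` A) \<le> Lp_norm \<infinity> (count_space A) f"
    using A f by (auto simp: AE_count_space Max_le_iff)
qed

text \<open>Viewing the sequence norm as an L_q norm for counting measure makes the Minkowski
  inequality above available for it. Nonnegativity enters because \<open>weighted_lq\<close> takes
  no absolute values.\<close>

lemma weighted_lq_eq_Lp_norm:
  assumes "\<And>u. u \<in> Pow {1..d} \<Longrightarrow> 0 \<le> a u / \<gamma> u"
  shows "weighted_lq d q \<gamma> a = Lp_norm q (count_space (Pow {1..d})) (\<lambda>u. a u / \<gamma> u)"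
proof (cases "q = \<infinity>")
  case True
  then show ?thesis
    using assms Lp_norm_infinity_count_space[of "Pow {1..d}" "\<lambda>u. a u / \<gamma> u"]
    by (simp add: weighted_lq_def Pow_not_empty)
next
  case False
  have "(\<Sum>u\<in>Pow {1..d}. \<bar>a u / \<gamma> u\<bar> powr enn2real q) = (\<Sum>u\<in>Pow {1..d}. (a u / \<gamma> u) powr enn2real q)"
    using assms by (intro sum.cong refl) (simp only: abs_of_nonneg)
  with False show ?thesis
    by (simp add: weighted_lq_def Lp_norm_def lebesgue_integral_count_space_finite del: abs_divide)
qed

text \<open>On the sets disjoint from \<open>w\<close> the map v \<mapsto> v \<union> w is
  injective, so the shifted family is a subfamily of \<open>b\<close> padded with zeros.\<close>

lemma Lp_norm_count_space_shift_le:
  assumes N: "finite N" and w: "w \<subseteq> N" and q: "1 \<le> q"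
  shows "Lp_norm q (count_space (Pow N)) (\<lambda>v. if v \<inter> w = {} then b (v \<union> w) else 0)
    \<le> Lp_norm q (count_space (Pow N)) b"
proof -
  let ?M = "count_space (Pow N)"
  have nz: "emeasure ?M (space ?M) \<noteq> 0"
    using N by (simp add: emeasure_count_space Pow_not_empty)
  note pos = Lp_norm_nonneg[OF nz, of q b]
  show ?thesis
  proof (cases "q = \<infinity>")
    case True
    have "\<forall>u\<in>Pow N. \<bar>b u\<bar> \<le> Lp_norm q ?M b"
      using Lp_norm_le_infinity_iff[OF nz pos, of b] in_Lp_count_space[of "Pow N" \<infinity> b] N True
      by (simp add: AE_count_space)
    then have "AE v in ?M. \<bar>if v \<inter> w = {} then b (v \<union> w) else 0\<bar> \<le> Lp_norm q ?M b"
      using pos w by (auto simp: AE_count_space)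
    then show ?thesis
      using Lp_norm_le_infinity_iff[OF nz pos, of "\<lambda>v. if v \<inter> w = {} then b (v \<union> w) else 0"] True
      by simp
  next
    case False
    have "(\<Sum>v\<in>Pow N. \<bar>if v \<inter> w = {} then b (v \<union> w) else 0\<bar> powr enn2real q)
        = (\<Sum>v\<in>Pow (N - w). \<bar>b (v \<union> w)\<bar> powr enn2real q)"
      using N by (intro sum.mono_neutral_cong_right) auto
    also have "\<dots> = (\<Sum>u\<in>(\<lambda>v. v \<union> w) ` Pow (N - w). \<bar>b u\<bar> powr enn2real q)"
      by (subst sum.reindex) (auto simp: inj_on_def)
    also have "\<dots> \<le> (\<Sum>u\<in>Pow N. \<bar>b u\<bar> powr enn2real q)"
      using N w by (intro sum_mono2) auto
    finally show ?thesis
      using False N by (auto simp: Lp_norm_def lebesgue_integral_count_space_finite intro!: powr_mono2 sum_nonneg)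
  qed
qed

text \<open>The weights are multiplicative on disjoint unions. Dividing by them turns
  \<open>le\<close> into a bound by shifts of one family with coefficients (r / d)^|w|; shifts do
  not increase the norm, and the coefficients sum to (1 + r / d)^d.\<close>

lemma weighted_lq_dim_weight_le:
  assumes d: "1 \<le> d" and q: "1 \<le> q" and r: "0 \<le> r"
    and a: "\<And>u. u \<in> Pow {1..d} \<Longrightarrow> 0 \<le> a u" and b: "\<And>u. u \<in> Pow {1..d} \<Longrightarrow> 0 \<le> b u"
    and le: "\<And>v. v \<in> Pow {1..d} \<Longrightarrow> a v \<le> (\<Sum>w\<in>Pow ({1..d} - v). r ^ card w * b (v \<union> w))"
  shows "weighted_lq d q (dim_weight d) a \<le> (1 + r / d) ^ d * weighted_lq d q (dim_weight d) b"
proof -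
  let ?N = "{1..d}" and ?M = "count_space (Pow {1..d})"
  define \<alpha> \<beta> where "\<alpha> v = a v / dim_weight d v" and "\<beta> v = b v / dim_weight d v" for v
  \<comment> \<open>Extension by 0 lets the sum over \<open>w\<close> run over one index set for all
    \<open>v\<close>, so that it becomes a sum of functions of \<open>v\<close>.\<close>
  define S where "S w v = (if v \<inter> w = {} then \<beta> (v \<union> w) else 0)" for w v
  have nz: "emeasure ?M (space ?M) \<noteq> 0"
    by (auto simp: emeasure_count_space Pow_not_empty)
  have \<alpha>\<beta>: "0 \<le> \<alpha> v" "0 \<le> \<beta> v" if "v \<in> Pow ?N" for v
    using a[OF that] b[OF that] by (auto simp: \<alpha>_def \<beta>_def dim_weight_def)
  have "\<alpha> v \<le> (\<Sum>w\<in>Pow ?N. (r / d) ^ card w * S w v)" if v: "v \<in> Pow ?N" for v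
  proof -
    have "\<alpha> v \<le> (\<Sum>w\<in>Pow (?N - v). r ^ card w * b (v \<union> w)) * real d ^ card v"
      unfolding \<alpha>_def dim_weight_def using le[OF v] by (simp add: mult_right_mono)
    also have "\<dots> = (\<Sum>w\<in>Pow (?N - v). (r / d) ^ card w * \<beta> (v \<union> w))"
      unfolding sum_distrib_right
    proof (intro sum.cong refl)
      fix w assume w: "w \<in> Pow (?N - v)"
      then have "finite v" "finite w" using v finite_subset[of v ?N] finite_subset[of w ?N] by auto
      then have "card (v \<union> w) = card v + card w"
        using w by (intro card_Un_disjoint) auto
      then show "r ^ card w * b (v \<union> w) * real d ^ card v = (r / d) ^ card w * \<beta> (v \<union> w)"
        using d by (simp add: \<beta>_def dim_weight_def power_add power_divide)
    qed
    also have "\<dots> = (\<Sum>w\<in>Pow ?N. (r / d) ^ card w * S w v)"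
      unfolding S_def by (intro sum.mono_neutral_cong_left) auto
    finally show ?thesis .
  qed
  then have "AE v in ?M. \<bar>\<alpha> v\<bar> \<le> \<bar>\<Sum>w\<in>Pow ?N. (r / d) ^ card w * S w v\<bar>"
    using \<alpha>\<beta> by (auto simp: AE_count_space intro: order_trans[OF _ abs_ge_self])
  then have "Lp_norm q ?M \<alpha> \<le> Lp_norm q ?M (\<lambda>v. \<Sum>w\<in>Pow ?N. (r / d) ^ card w * S w v)"
    by (intro Lp_norm_mono nz q in_Lp_count_space) auto
  also have "\<dots> \<le> (\<Sum>w\<in>Pow ?N. Lp_norm q ?M (\<lambda>v. (r / d) ^ card w * S w v))"
    by (intro Lp_norm_sum_le nz q in_Lp_count_space) auto
  also have "\<dots> \<le> (\<Sum>w\<in>Pow ?N. (r / d) ^ card w * Lp_norm q ?M \<beta>)"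
  proof (intro sum_mono)
    fix w assume "w \<in> Pow ?N"
    then have "Lp_norm q ?M (S w) \<le> Lp_norm q ?M \<beta>"
      using Lp_norm_count_space_shift_le[of ?N w q \<beta>] q by (simp add: S_def[abs_def])
    then show "Lp_norm q ?M (\<lambda>v. (r / d) ^ card w * S w v) \<le> (r / d) ^ card w * Lp_norm q ?M \<beta>"
      using r by (subst Lp_norm_cmult[OF nz q]) (simp add: mult_left_mono)
  qed
  also have "\<dots> = (1 + r / d) ^ d * Lp_norm q ?M \<beta>"
    by (simp add: sum_Pow_power_card flip: sum_distrib_right)
  finally show ?thesis
    using \<alpha>\<beta> by (subst (1 2) weighted_lq_eq_Lp_norm) (auto simp: \<alpha>_def[abs_def] \<beta>_def[abs_def])
qed

section \<open>Uniqueness of the components of a sum\<close>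

context kernel_prob
begin

lemma Tk_diff:
  assumes u: "finite u" and g: "integrable (PM u) g" and h: "integrable (PM u) h"
    and k: "\<And>j. j \<in> u \<Longrightarrow> k (x j) \<in> borel_measurable M" "\<And>j. j \<in> u \<Longrightarrow> \<exists>B. AE t in M. \<bar>k (x j) t\<bar> \<le> B"
  shows "Tk k u (\<lambda>t. g t - h t) x = Tk k u g x - Tk k u h x"
  using integrable_mult_prod[OF u g k] integrable_mult_prod[OF u h k]
  by (simp add: Tk_def left_diff_distrib)

text \<open>Setting all coordinates outside \<open>u\<close> to the anchor \<open>z\<close> kills
  every term whose index set is not contained in \<open>u\<close>. Proper subsets of
  \<open>u\<close> are settled by induction, so the term of \<open>u\<close> is left alone and
  \<open>Tk_injective\<close> applies.\<close>

lemma sum_Tk_injective: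
  assumes N: "finite N" and g: "\<And>u. u \<in> Pow N \<Longrightarrow> integrable (PM u) (g u)"
    and k: "\<And>x. x \<in> X \<Longrightarrow> k x \<in> borel_measurable M" "\<And>x. x \<in> X \<Longrightarrow> \<exists>B. AE t in M. \<bar>k x t\<bar> \<le> B"
    and z: "z \<in> X" "\<And>t. k z t = 0"
    and separating: "\<And>H. integrable M H \<Longrightarrow> (\<And>x. x \<in> X \<Longrightarrow> (\<integral>s. H s * k x s \<partial>M) = 0) \<Longrightarrow> AE s in M. H s = 0"
    and zero: "\<And>x. (\<And>j. j \<in> N \<Longrightarrow> x j \<in> X) \<Longrightarrow> (\<Sum>u\<in>Pow N. Tk k u (g u) x) = 0"
    and u: "u \<in> Pow N"
  shows "AE t in PM u. g u t = 0"
  using u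
proof (induction "card u" arbitrary: u rule: less_induct)
  case less
  then have u: "finite u" "u \<subseteq> N" using N by (auto intro: finite_subset)
  show ?case
  proof (rule Tk_injective[OF u(1) g[OF less.prems] k separating])
    fix x assume x: "\<And>j. j \<in> u \<Longrightarrow> x j \<in> X"
    define y where "y = (\<lambda>j. if j \<in> u then x j else z)"
    have "Tk k v (g v) y = 0" if v: "v \<in> Pow N - {u}" for v
    proof (cases "v \<subseteq> u")
      case True
      then have "AE t in PM v. g v t = 0"
        using v u by (intro less.hyps psubset_card_mono) auto
      then show ?thesis
        unfolding Tk_def by (intro integral_eq_zero_AE) (auto elim: eventually_mono)
    next
      case False
      then obtain j where "j \<in> v" "j \<notin> u" by auto
      moreover have "finite v" using v N by (auto intro: finite_subset)
      ultimately have "(\<Prod>i\<in>v. k (y i) (t i)) = 0" for t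
        using z(2) by (auto simp: y_def prod_zero_iff)
      then show ?thesis by (simp add: Tk_def)
    qed
    then have "(\<Sum>v\<in>Pow N. Tk k v (g v) y) = Tk k u (g u) y"
      using N less.prems by (subst sum.remove[of _ u]) auto
    moreover have "(\<Sum>v\<in>Pow N. Tk k v (g v) y) = 0"
      using x z by (intro zero) (auto simp: y_def)
    moreover have "Tk k u (g u) y = Tk k u (g u) x"
      by (simp add: Tk_def y_def)
    ultimately show "Tk k u (g u) x = 0" by simp
  qed auto
qed

end

section \<open>The measure with density \<open>\<psi>\<close>\<close>

lemma borel_measurable_coordinate_prod:
  fixes f :: "'i \<Rightarrow> 'a \<Rightarrow> real"
  assumes "\<And>j. j \<in> u \<Longrightarrow> f j \<in> borel_measurable N"
  shows "(\<lambda>t. \<Prod>j\<in>u. f j (t j)) \<in> borel_measurable (Pi\<^sub>M u (\<lambda>_. N))"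
  using assms by (auto intro!: borel_measurable_prod measurable_compose[OF measurable_component_singleton])

lemma sigma_finite_lebesgue_on:
  fixes D :: "'a::euclidean_space set"
  assumes "D \<in> sets lebesgue"
  shows "sigma_finite_measure (lebesgue_on D)"
proof -
  interpret lborel: sigma_finite_measure "lborel :: 'a measure" by (rule sigma_finite_lborel)
  obtain A :: "nat \<Rightarrow> 'a set" where A: "range A \<subseteq> sets lborel" "(\<Union>i. A i) = space lborel"
    "\<And>i. emeasure lborel (A i) \<noteq> \<infinity>" using lborel.sigma_finite by metis
  have "sigma_finite_measure (lebesgue :: 'a measure)"
  proof
    show "\<exists>A. countable A \<and> A \<subseteq> sets (lebesgue :: 'a measure) \<and> \<Union> A = space lebesgue \<and>
        (\<forall>a\<in>A. emeasure lebesgue a \<noteq> \<infinity>)"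
      using A by (intro exI[of _ "range A"]) (auto simp: image_subset_iff sets_completionI_sets)
  qed
  then show ?thesis
    using assms by (rule sigma_finite_measure_restrict_space)
qed

text \<open>Half-lines generate the Borel sets but not the Lebesgue sets. The argument is therefore
  carried out for a Borel function \<open>g\<close> equal to \<open>f\<close> almost
  everywhere.\<close>

lemma AE_zero_if_integral_lessThan_zero:
  fixes f :: "real \<Rightarrow> real"
  assumes f: "integrable lebesgue f" and total: "(\<integral>t. f t \<partial>lebesgue) = 0"
    and zero: "\<And>y. (LINT t:{..<y}|lebesgue. f t) = 0"
  shows "AE t in lebesgue. f t = 0"
proof -
  obtain g where g: "g \<in> borel_measurable lborel" "AE t in lborel. f t = g t"
    using completion_ex_borel_measurable_real[of f lborel] f by auto
  then have ae: "AE t in lebesgue. f t = g t" by (intro AE_completion)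
  have [measurable]: "f \<in> borel_measurable lebesgue" "g \<in> borel_measurable lebesgue"
    using f g(1) by (auto intro: measurable_completion)
  have gi: "integrable lborel g"
    using integrable_cong_AE[of f lebesgue g] f ae integrable_completion[OF g(1)] by simp
  have "AE t in lborel. g t = 0"
  proof (rule lborel.AE_zero_if_integral_zero_on_generator[OF gi, where G = "range lessThan"])
    show "sets lborel = sigma_sets (space lborel) (range (lessThan :: real \<Rightarrow> real set))"
      by (simp add: borel_Iio)
    show "Int_stable (range (lessThan :: real \<Rightarrow> real set))"
      by (force simp: Int_stable_def intro!: image_eqI[where x = "min _ _"])
    have "(\<integral>t. g t \<partial>lborel) = (\<integral>t. g t \<partial>lebesgue)"
      by (rule integral_completion[symmetric, OF g(1)])
    also have "\<dots> = (\<integral>t. f t \<partial>lebesgue)"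
      using ae by (intro integral_cong_AE) (auto elim: eventually_mono)
    finally show "(\<integral>t. g t \<partial>lborel) = 0" by (simp add: total)
    show "(LINT t:A|lborel. g t) = 0" if "A \<in> range lessThan" for A
    proof -
      from that obtain y where y: "A = {..<y}" by auto
      have [measurable]: "{..<y} \<in> sets lebesgue" by auto
      have "(LINT t:A|lborel. g t) = (LINT t:A|lebesgue. g t)"
        unfolding set_lebesgue_integral_def y using g(1)
        by (intro integral_completion[symmetric]) auto
      also have "\<dots> = (LINT t:A|lebesgue. f t)"
        unfolding set_lebesgue_integral_def y
      proof (rule integral_cong_AE)
        show "AE t in lebesgue. indicat_real {..<y} t *\<^sub>R g t = indicat_real {..<y} t *\<^sub>R f t"
          using ae by eventually_elim simp
      qed measurable
      finally show ?thesis by (simp add: y zero)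
    qed
  qed auto
  then have "AE t in lebesgue. g t = 0" by (rule AE_completion)
  with ae show ?thesis by eventually_elim simp
qed

section \<open>The interval and density of the theorem\<close>

locale weighted_setting =
  fixes D :: "real set" and \<psi> :: "real \<Rightarrow> real"
  assumes D: "admissible_interval D" and psi: "admissible_density D \<psi>"
    and cond: "integrability_condition D \<psi> 1"
begin

abbreviation L :: "real measure" where "L \<equiv> lebesgue_on D"

definition \<mu> :: "real measure" where "\<mu> = density L (\<lambda>t. ennreal (\<psi> t))"

definition ratio :: "real \<Rightarrow> real" where "ratio t = psibar D \<psi> t / \<psi> t"

text \<open>The kernel for integration against \<open>\<mu>\<close>. Where \<open>\<psi>\<close>
  vanishes in \<open>D\<close> the quotient is 0 by convention, which concerns a null set
  only.\<close>

definition kpsi :: "decomp \<Rightarrow> real \<Rightarrow> real \<Rightarrow> real" where "kpsi s x t = kern s D \<psi> x t / \<psi> t"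

lemma D_borel: "D \<in> sets borel"
  using D by (auto simp: admissible_interval_def)

lemma D_lebesgue[measurable]: "D \<in> sets lebesgue"
  using D_borel by auto

lemma D_nonneg: "t \<in> D \<Longrightarrow> 0 \<le> t"
  using D by (auto simp: admissible_interval_def)

lemma zero_in_D: "0 \<in> D"
  using D by (auto simp: admissible_interval_def)

lemma D_downward: "x \<in> D \<Longrightarrow> 0 \<le> y \<Longrightarrow> y \<le> x \<Longrightarrow> y \<in> D"
  using D by (auto simp: admissible_interval_def)

lemma space_L[simp]: "space L = D"
  by simp

lemma space_mu[simp]: "space \<mu> = D"
  by (simp add: \<mu>_def)

lemma sets_mu[simp, measurable_cong]: "sets \<mu> = sets L"
  by (simp add: \<mu>_def)

lemma psi_measurable[measurable]: "\<psi> \<in> borel_measurable L"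
  using psi by (simp add: admissible_density_def)

lemma psi_nonneg: "t \<in> D \<Longrightarrow> 0 \<le> \<psi> t"
  using psi by (simp add: admissible_density_def)

lemma psi_pos: "AE t in L. 0 < \<psi> t"
  using psi by (simp add: admissible_density_def)

lemma psi_AE_nonneg: "AE t in L. 0 \<le> \<psi> t"
  using psi_pos by eventually_elim simp

lemma borel_measurable_ident_L[measurable]: "(\<lambda>t. t) \<in> borel_measurable L"
  by (intro measurable_restrict_space1 measurable_completion) simp

text \<open>As \<open>\<psi>\<close> is positive almost everywhere, \<open>\<mu>\<close> and
  Lebesgue measure on \<open>D\<close> have the same null sets.\<close>

lemma AE_mu_iff: "(AE t in \<mu>. Q t) \<longleftrightarrow> (AE t in L. Q t)"
proof -
  have "(AE t in \<mu>. Q t) \<longleftrightarrow> (AE t in L. 0 < \<psi> t \<longrightarrow> Q t)"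
    unfolding \<mu>_def by (subst AE_density) auto
  also have "\<dots> \<longleftrightarrow> (AE t in L. Q t)"
    using psi_pos by (auto elim: eventually_elim2)
  finally show ?thesis .
qed

lemma integral_mu: "f \<in> borel_measurable L \<Longrightarrow> (\<integral>t. f t \<partial>\<mu>) = (\<integral>t. \<psi> t * f t \<partial>L)"
  unfolding \<mu>_def using psi_AE_nonneg by (subst integral_density) auto

lemma integrable_mu_iff: "f \<in> borel_measurable L \<Longrightarrow> integrable \<mu> f \<longleftrightarrow> integrable L (\<lambda>t. \<psi> t * f t)"
  unfolding \<mu>_def using psi_AE_nonneg by (subst integrable_density) auto

lemma sigma_finite_L: "sigma_finite_measure L"
  using D_lebesgue by (rule sigma_finite_lebesgue_on)

lemma prob_space_mu: "prob_space \<mu>"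
proof
  have "emeasure \<mu> (space \<mu>) = (\<integral>\<^sup>+t. ennreal (\<psi> t) \<partial>L)"
    unfolding \<mu>_def by (subst emeasure_density) (auto intro!: nn_integral_cong simp: indicator_def)
  also have "\<dots> = ennreal (\<integral>t. \<psi> t \<partial>L)"
    using psi psi_AE_nonneg by (intro nn_integral_eq_integral) (auto simp: admissible_density_def)
  also have "\<dots> = 1" using psi by (simp add: admissible_density_def)
  finally show "emeasure \<mu> (space \<mu>) = 1" .
qed

lemma psibar_eq: "psibar D \<psi> t = (\<integral>y. indicator {t..} y * \<psi> y \<partial>L)"
proof -
  have "D \<inter> {t..} \<in> sets lebesgue" by auto
  then show ?thesis
    unfolding psibar_def using D_lebesgue
    by (simp add: integral_restrict_space indicator_inter_arith mult_ac)
qed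

lemma psibar_measurable[measurable]: "psibar D \<psi> \<in> borel_measurable L"
proof -
  interpret sigma_finite_measure L by (rule sigma_finite_L)
  \<comment> \<open>A parameter integral of a jointly measurable function is measurable in the
    parameter.\<close>
  have eq: "psibar D \<psi> = (\<lambda>t. \<integral>y. (if t \<le> y then \<psi> y else 0) \<partial>L)"
    by (auto simp: fun_eq_iff psibar_eq intro!: Bochner_Integration.integral_cong)
  show ?thesis unfolding eq by measurable
qed

lemma psibar_nonneg: "0 \<le> psibar D \<psi> t"
  unfolding psibar_eq using psi_nonneg by (intro integral_nonneg_AE) auto

lemma ratio_measurable[measurable]: "ratio \<in> borel_measurable L"
  unfolding ratio_def[abs_def] by measurable

lemma ratio_nonneg: "t \<in> D \<Longrightarrow> 0 \<le> ratio t"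
  using psi_nonneg psibar_nonneg by (simp add: ratio_def)

lemma L_nonzero: "emeasure L (space L) \<noteq> 0"
proof
  assume "emeasure L (space L) = 0"
  then have "AE t in L. False" by (rule emeasure_0_AE)
  then have "AE t in \<mu>. False" by (simp only: AE_mu_iff)
  then show False using prob_space.AE_False[OF prob_space_mu] by simp
qed

lemma ratio_in_Lp: "in_Lp \<infinity> L ratio"
proof -
  obtain C where "AE t in L. \<bar>psibar D \<psi> t * \<psi> t powr (- 1 / enn2real 1)\<bar> \<le> C"
    using cond by (auto simp: integrability_condition_def conj_exp_1 in_Lp_def)
  with psi_pos have "AE t in L. \<bar>ratio t\<bar> \<le> C"
    by eventually_elim (simp add: ratio_def powr_minus_divide)
  then show ?thesis by (auto simp: in_Lp_def)
qed

lemma ratio_le_kappa: "AE t in L. ratio t \<le> kappa_psi D \<psi>"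
proof -
  have "AE t in L. \<bar>ratio t\<bar> \<le> kappa_psi D \<psi>"
    using Lp_norm_le_infinity_iff[OF L_nonzero Lp_norm_nonneg[OF L_nonzero, of \<infinity> ratio], of ratio]
      ratio_in_Lp by (simp add: kappa_psi_def ratio_def[abs_def])
  then show ?thesis by eventually_elim simp
qed

sublocale kernel_prob \<mu> ratio "kappa_psi D \<psi>"
proof (intro kernel_prob.intro prob_space_mu kernel_prob_axioms.intro)
  show "ratio \<in> borel_measurable \<mu>" by measurable
  show "AE t in \<mu>. 0 \<le> ratio t \<and> ratio t \<le> kappa_psi D \<psi>"
    unfolding AE_mu_iff using ratio_le_kappa AE_space by eventually_elim (auto simp: ratio_nonneg)
qed

lemma rate_infinity: "rate \<infinity> = m_psi D \<psi>"
proof -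
  have "(\<integral>t. ratio t \<partial>\<mu>) = (\<integral>t. \<psi> t * ratio t \<partial>L)" by (rule integral_mu) measurable
  also have "\<dots> = (\<integral>t. psibar D \<psi> t \<partial>L)"
    using psi_pos by (intro integral_cong_AE) (auto simp: ratio_def elim: eventually_mono)
  finally show ?thesis by (simp add: rate_def m_psi_def)
qed

lemma rate_one: "rate 1 = kappa_psi D \<psi>"
  by (simp add: rate_def)

lemma kpsi_measurable: "kpsi s x \<in> borel_measurable \<mu>"
proof -
  have [measurable]: "(indicator {0..<x} :: real \<Rightarrow> real) \<in> borel_measurable L"
    by (intro measurable_restrict_space1 measurable_completion) simp
  show ?thesis unfolding kpsi_def[abs_def] by (cases s) (simp_all, measurable)
qed

text \<open>This is the local half of the integrability condition for p = 1: the conjugate index is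
  infinity, so 1 / \<open>\<psi>\<close> is essentially bounded on [0, x).\<close>

lemma kpsi_Anchored_bounded:
  assumes x: "x \<in> D"
  shows "\<exists>B. AE t in \<mu>. \<bar>kpsi Anchored x t\<bar> \<le> B"
proof -
  obtain C where "AE t in lebesgue_on {0..<x}. \<bar>\<psi> t powr (- 1 / enn2real 1)\<bar> \<le> C"
    using cond x by (auto simp: integrability_condition_def conj_exp_1 in_Lp_def in_Lp_loc_def)
  then have "AE t in lebesgue. t \<in> {0..<x} \<longrightarrow> \<bar>\<psi> t powr (- 1 / enn2real 1)\<bar> \<le> C"
    by (subst (asm) AE_restrict_space_iff) auto
  moreover have "AE t in lebesgue. t \<in> D \<longrightarrow> 0 < \<psi> t"
    using psi_pos by (subst (asm) AE_restrict_space_iff) auto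
  ultimately have "AE t in lebesgue. t \<in> D \<longrightarrow> \<bar>kpsi Anchored x t\<bar> \<le> max 0 C"
    by eventually_elim (auto simp: kpsi_def indicator_def powr_minus_divide intro: max.coboundedI2)
  then have "AE t in L. \<bar>kpsi Anchored x t\<bar> \<le> max 0 C"
    by (subst AE_restrict_space_iff) auto
  then show ?thesis unfolding AE_mu_iff by blast
qed

lemma kpsi_Anova: "kpsi Anova x t = kpsi Anchored x t + (- 1) * ratio t"
  by (simp add: kpsi_def ratio_def diff_divide_distrib)

lemma kpsi_bounded:
  assumes x: "x \<in> D"
  shows "\<exists>B. AE t in \<mu>. \<bar>kpsi s x t\<bar> \<le> B"
proof (cases s)
  case Anchored
  with kpsi_Anchored_bounded[OF x] show ?thesis by simp
next
  case Anova
  obtain B where "AE t in \<mu>. \<bar>kpsi Anchored x t\<bar> \<le> B"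
    using kpsi_Anchored_bounded[OF x] by blast
  with rho_bounds have "AE t in \<mu>. \<bar>kpsi Anova x t\<bar> \<le> B + kappa_psi D \<psi>"
    by eventually_elim (simp only: kpsi_Anova, linarith)
  with Anova show ?thesis by blast
qed

text \<open>The density of \<open>\<mu>\<close> cancels the denominator of the kernel, so the
  hypothesis says that the Lebesgue integral of \<open>H\<close> over [0, x) is 0 for all x in
  \<open>D\<close>. This forces \<open>H\<close> to vanish almost everywhere on each of these
  intervals.\<close>

lemma kpsi_separating:
  assumes H: "integrable \<mu> H" and zero: "\<And>x. x \<in> D \<Longrightarrow> (\<integral>s. H s * kpsi Anchored x s \<partial>\<mu>) = 0"
  shows "AE s in \<mu>. H s = 0"
proof -
  have Hm[measurable]: "H \<in> borel_measurable L" using H by auto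
  have local: "AE t in lebesgue. t \<in> {0..<x} \<longrightarrow> H t = 0" if x: "x \<in> D" for x
  proof -
    define f where "f t = indicator {0..<x} t * H t" for t
    have restr: "integrable lebesgue (\<lambda>t. indicator {0..<y} t * H t) \<and>
        (\<integral>t. indicator {0..<y} t * H t \<partial>lebesgue) = 0" if y: "y \<in> D" for y
    proof -
      have suby: "{0..<y} \<subseteq> D" using D_downward[OF y] by auto
      have int: "integrable \<mu> (\<lambda>t. H t * kpsi Anchored y t)"
        using kpsi_Anchored_bounded[OF y] integrable_mult_AE_bounded[OF H kpsi_measurable] by blast
      have [measurable]: "(indicator {0..<y} :: real \<Rightarrow> real) \<in> borel_measurable L"
        by (intro measurable_restrict_space1 measurable_completion) simp
      have km[measurable]: "kpsi Anchored y \<in> borel_measurable L"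
        using kpsi_measurable[of Anchored y] by simp
      have eq: "AE t in L. \<psi> t * (H t * kpsi Anchored y t) = indicator {0..<y} t * H t"
        using psi_pos by eventually_elim (simp add: kpsi_def)
      have "integrable L (\<lambda>t. \<psi> t * (H t * kpsi Anchored y t))"
        using int by (subst (asm) integrable_mu_iff) auto
      then have "integrable L (\<lambda>t. indicator {0..<y} t * H t)"
        using eq by (subst (asm) integrable_cong_AE[OF _ _ eq]) auto
      moreover have "(\<integral>t. indicator {0..<y} t * H t \<partial>L) = (\<integral>t. \<psi> t * (H t * kpsi Anchored y t) \<partial>L)"
        using eq by (intro integral_cong_AE) auto
      moreover have "\<dots> = 0"
        using zero[OF y] by (subst (asm) integral_mu) auto
      moreover have "(\<lambda>t. indicator D t *\<^sub>R (indicator {0..<y} t * H t)) = (\<lambda>t. indicator {0..<y} t * H t)"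
        using suby by (auto simp: indicator_def fun_eq_iff)
      ultimately show ?thesis
        using integrable_restrict_space[of D lebesgue "\<lambda>t. indicator {0..<y} t * H t"]
          integral_restrict_space[of D lebesgue "\<lambda>t. indicator {0..<y} t * H t"] by simp
    qed
    have "AE t in lebesgue. f t = 0"
    proof (rule AE_zero_if_integral_lessThan_zero)
      show "integrable lebesgue f" "(\<integral>t. f t \<partial>lebesgue) = 0"
        using restr[OF x] by (simp_all add: f_def[abs_def])
      fix y :: real
      \<comment> \<open>Clamping \<open>y\<close> to [0, x] yields a point of \<open>D\<close> and
        does not change the part of [0, x) below it.\<close>
      define y' where "y' = max 0 (min x y)"
      have "y' \<in> D" using D_downward[OF x] D_nonneg[OF x] by (auto simp: y'_def)
      moreover have "indicat_real {..<y} t *\<^sub>R f t = indicator {0..<y'} t * H t" for t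
        by (auto simp: f_def y'_def indicator_def)
      ultimately show "(LINT t:{..<y}|lebesgue. f t) = 0"
        using restr[of y'] by (simp add: set_lebesgue_integral_def)
    qed
    then show ?thesis by eventually_elim (auto simp: f_def indicator_def)
  qed
  \<comment> \<open>Countably many exceptional null sets can be united, and rational endpoints
    already cover every point of \<open>D\<close> except a largest one.\<close>
  have "AE t in lebesgue. \<forall>x\<in>D \<inter> \<rat>. t \<in> {0..<x} \<longrightarrow> H t = 0"
    using local countable_rat by (intro AE_ball_countable') (auto intro: countable_subset)
  \<comment> \<open>A closed interval \<open>D\<close> has a right endpoint that lies in no [0, x)
    with x in \<open>D\<close>; it is a single point.\<close>
  moreover have "AE t in lebesgue. t \<notin> {t\<in>D. \<forall>x\<in>D. x \<le> t}"
  proof (rule AE_not_in)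
    have "finite {t\<in>D. \<forall>x\<in>D. x \<le> t}"
    proof (cases "{t\<in>D. \<forall>x\<in>D. x \<le> t} = {}")
      case False
      then obtain T where "T \<in> D" "\<forall>x\<in>D. x \<le> T" by blast
      then have "{t\<in>D. \<forall>x\<in>D. x \<le> t} \<subseteq> {T}" by (auto intro: antisym)
      then show ?thesis by (rule finite_subset) simp
    qed (simp only: finite.emptyI)
    then show "{t\<in>D. \<forall>x\<in>D. x \<le> t} \<in> null_sets lebesgue"
      using negligible_finite negligible_iff_null_sets by blast
  qed
  ultimately have "AE t in lebesgue. t \<in> D \<longrightarrow> H t = 0"
  proof eventually_elim
    case (elim t)
    show ?case
    proof
      assume t: "t \<in> D"
      with elim obtain x where "x \<in> D" "t < x" by (auto simp: not_le)
      moreover then obtain r where "r \<in> \<rat>" "t < r" "r < x" using Rats_dense_in_real by blast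
      ultimately show "H t = 0"
        using elim(1) D_nonneg[OF t] D_downward[of x r] by fastforce
    qed
  qed
  then show ?thesis
    unfolding AE_mu_iff by (subst AE_restrict_space_iff) auto
qed

sublocale PL: product_sigma_finite "\<lambda>_::nat. L"
  by (intro product_sigma_finite.intro sigma_finite_L)

text \<open>The factors here need not be probability measures, so \<open>AE_PM_all\<close> is out of
  reach. The exceptional set of one coordinate is instead enclosed in a box with one null
  side.\<close>

lemma AE_leb_power_psi_pos:
  assumes u: "finite u"
  shows "AE t in leb_power D u. \<forall>j\<in>u. 0 < \<psi> (t j)"
proof -
  have "AE t in leb_power D u. 0 < \<psi> (t j)" if j: "j \<in> u" for j
  proof -
    let ?Z = "{t\<in>D. \<not> 0 < \<psi> t}"
    have Z: "?Z \<in> sets L"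
      using measurable_sets[OF psi_measurable, of "{..0}"] by (auto simp: vimage_def not_less Int_def conj_commute)
    then have nullZ: "emeasure L ?Z = 0"
      using psi_pos AE_iff_measurable[OF Z, of "\<lambda>t. 0 < \<psi> t"] by simp
    let ?A = "\<lambda>i. if i = j then ?Z else D"
    have "emeasure (leb_power D u) (Pi\<^sub>E u ?A) = (\<Prod>i\<in>u. emeasure L (?A i))"
      unfolding leb_power_def using u Z by (intro PL.emeasure_PiM) (auto simp: sets.top[of L, simplified])
    \<comment> \<open>Other sides of the box may have infinite measure; in \<open>ennreal\<close>
      the product with 0 is still 0.\<close>
    also have "\<dots> = 0" using u j nullZ by (intro prod_zero) auto
    finally have "emeasure (leb_power D u) (Pi\<^sub>E u ?A) = 0" .
    moreover have "Pi\<^sub>E u ?A \<in> sets (leb_power D u)"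
      unfolding leb_power_def using u Z by (intro sets_PiM_I_finite) (auto simp: sets.top[of L, simplified])
    moreover have "{t \<in> space (leb_power D u). \<not> 0 < \<psi> (t j)} \<subseteq> Pi\<^sub>E u ?A"
      by (auto simp: leb_power_def space_PiM PiE_iff extensional_def)
    ultimately show ?thesis by (intro AE_I[of _ _ "Pi\<^sub>E u ?A"]) auto
  qed
  then show ?thesis using u by (intro AE_finite_allI) auto
qed

lemma prod_psi_measurable:
  "(\<lambda>t. \<Prod>j\<in>u. \<psi> (t j)) \<in> borel_measurable (leb_power D u)"
  unfolding leb_power_def
  by (intro borel_measurable_coordinate_prod psi_measurable)

text \<open>The product density factorizes over boxes, and boxes determine the product
  measure.\<close>

lemma weighted_power_eq:
  assumes u: "finite u"
  shows "weighted_power D \<psi> u = PM u"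
proof (rule P.PiM_eqI[OF u])
  show "sets (weighted_power D \<psi> u) = sets (PM u)"
    unfolding weighted_power_def leb_power_def by (simp cong: sets_PiM_cong)
  fix A assume A: "\<And>i. i \<in> u \<Longrightarrow> A i \<in> sets \<mu>"
  have [measurable]: "Pi\<^sub>E u A \<in> sets (leb_power D u)"
    unfolding leb_power_def using A u by (intro sets_PiM_I_finite) auto
  have "emeasure (weighted_power D \<psi> u) (Pi\<^sub>E u A)
      = (\<integral>\<^sup>+t. ennreal (\<Prod>j\<in>u. \<psi> (t j)) * indicator (Pi\<^sub>E u A) t \<partial>leb_power D u)"
    unfolding weighted_power_def using prod_psi_measurable
    by (intro emeasure_density) auto
  also have "\<dots> = (\<integral>\<^sup>+t. (\<Prod>j\<in>u. ennreal (\<psi> (t j)) * indicator (A j) (t j)) \<partial>leb_power D u)"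
  proof (intro nn_integral_cong)
    fix t assume t: "t \<in> space (leb_power D u)"
    then have "(indicator (Pi\<^sub>E u A) t :: ennreal) = (\<Prod>j\<in>u. indicator (A j) (t j))"
      using u by (auto simp: indicator_def leb_power_def space_PiM PiE_iff)
    moreover have "ennreal (\<Prod>j\<in>u. \<psi> (t j)) = (\<Prod>j\<in>u. ennreal (\<psi> (t j)))"
      using t by (subst prod_ennreal) (auto simp: leb_power_def space_PiM intro!: psi_nonneg)
    ultimately show "ennreal (\<Prod>j\<in>u. \<psi> (t j)) * indicator (Pi\<^sub>E u A) t
        = (\<Prod>j\<in>u. ennreal (\<psi> (t j)) * indicator (A j) (t j))"
      by (simp add: prod.distrib)
  qed
  also have "\<dots> = (\<Prod>j\<in>u. \<integral>\<^sup>+t. ennreal (\<psi> t) * indicator (A j) t \<partial>L)"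
    unfolding leb_power_def using A
    by (intro PL.product_nn_integral_prod u) auto
  also have "\<dots> = (\<Prod>j\<in>u. emeasure \<mu> (A j))"
    using A by (intro prod.cong refl) (auto simp: \<mu>_def emeasure_density)
  finally show "emeasure (weighted_power D \<psi> u) (Pi\<^sub>E u A) = (\<Prod>j\<in>u. emeasure \<mu> (A j))" .
qed

text \<open>Almost everywhere the product of the densities is nonzero and cancels the denominators
  of the \<open>kpsi\<close>.\<close>

lemma T_op_eq_Tk:
  assumes u: "finite u" and g: "g \<in> borel_measurable (PM u)"
  shows "T_op s D \<psi> u g x = Tk (kpsi s) u g x"
proof -
  have g': "g \<in> borel_measurable (leb_power D u)"
    using g unfolding leb_power_def by (simp cong: measurable_cong_sets sets_PiM_cong)
  have k: "(\<lambda>t. \<Prod>j\<in>u. kpsi s (x j) (t j)) \<in> borel_measurable (leb_power D u)"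
    unfolding leb_power_def using kpsi_measurable
    by (intro borel_measurable_coordinate_prod) auto
  have kern: "kern s D \<psi> (x j) \<in> borel_measurable L" for j
  proof -
    have [measurable]: "(indicator {0..<x j} :: real \<Rightarrow> real) \<in> borel_measurable L"
      by (intro measurable_restrict_space1 measurable_completion) simp
    have "kern Anchored D \<psi> (x j) = indicator {0..<x j}"
      "kern Anova D \<psi> (x j) = (\<lambda>t. indicator {0..<x j} t - psibar D \<psi> t)"
      by (auto simp: fun_eq_iff)
    then show ?thesis by (cases s) auto
  qed
  have kernp: "(\<lambda>t. \<Prod>j\<in>u. kern s D \<psi> (x j) (t j)) \<in> borel_measurable (leb_power D u)"
    unfolding leb_power_def
    by (intro borel_measurable_coordinate_prod kern)
  have "Tk (kpsi s) u g x = (\<integral>t. (\<Prod>j\<in>u. \<psi> (t j)) *\<^sub>R (g t * (\<Prod>j\<in>u. kpsi s (x j) (t j))) \<partial>leb_power D u)"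
    unfolding Tk_def weighted_power_eq[OF u, symmetric] weighted_power_def
  proof (rule integral_density)
    show "AE t in leb_power D u. 0 \<le> (\<Prod>j\<in>u. \<psi> (t j))"
      using AE_leb_power_psi_pos[OF u] by eventually_elim (rule prod_nonneg, auto simp: less_imp_le)
  qed (use g' k prod_psi_measurable in auto)
  also have "\<dots> = (\<integral>t. g t * (\<Prod>j\<in>u. kern s D \<psi> (x j) (t j)) \<partial>leb_power D u)"
  proof (rule integral_cong_AE)
    show "AE t in leb_power D u. (\<Prod>j\<in>u. \<psi> (t j)) *\<^sub>R (g t * (\<Prod>j\<in>u. kpsi s (x j) (t j)))
        = g t * (\<Prod>j\<in>u. kern s D \<psi> (x j) (t j))"
      using AE_leb_power_psi_pos[OF u]
    proof eventually_elim
      case (elim t)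
      then have "(\<Prod>j\<in>u. \<psi> (t j)) * (\<Prod>j\<in>u. kpsi s (x j) (t j)) = (\<Prod>j\<in>u. kern s D \<psi> (x j) (t j))"
        unfolding prod.distrib[symmetric] by (intro prod.cong) (auto simp: kpsi_def)
      then show ?case by simp
    qed
  qed (use g' k kernp prod_psi_measurable in auto)
  finally show ?thesis by (simp add: T_op_def)
qed

end

section \<open>The spaces of functions\<close>

context weighted_setting
begin

lemma W_rep_iff:
  "W_rep s D \<psi> d p f g \<longleftrightarrow> (\<forall>u\<in>Pow {1..d}. in_Lp p (PM u) (g u)) \<and>
    f = (\<lambda>x \<in> PiE {1..d} (\<lambda>_. D). \<Sum>u\<in>Pow {1..d}. Tk (kpsi s) u (g u) x)"
proof -
  have "in_Lp p (weighted_power D \<psi> u) (g u) \<longleftrightarrow> in_Lp p (PM u) (g u)" if "u \<in> Pow {1..d}" for u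
    using that by (subst weighted_power_eq) (auto intro: finite_subset)
  moreover have "(\<Sum>u\<in>Pow {1..d}. T_op s D \<psi> u (g u) x) = (\<Sum>u\<in>Pow {1..d}. Tk (kpsi s) u (g u) x)"
    if "\<forall>u\<in>Pow {1..d}. in_Lp p (PM u) (g u)" for x
  proof (intro sum.cong refl T_op_eq_Tk)
    fix u assume u: "u \<in> Pow {1..d}"
    then show "finite u" using finite_subset[of u "{1..d}"] by simp
    from that u show "g u \<in> borel_measurable (PM u)" by (intro in_Lp_measurable) blast
  qed
  ultimately show ?thesis unfolding W_rep_def by (auto cong: restrict_cong)
qed

lemma W_rep_switch:
  assumes rep: "W_rep s D \<psi> d p f g" and p: "1 \<le> p"
    and \<sigma>: "\<And>x t. kpsi s x t = kpsi s' x t + \<sigma> * ratio t"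
  shows "W_rep s' D \<psi> d p f (switch \<sigma> {1..d} g)"
proof -
  from rep have g: "\<And>u. u \<in> Pow {1..d} \<Longrightarrow> in_Lp p (PM u) (g u)"
    and f: "f = (\<lambda>x \<in> PiE {1..d} (\<lambda>_. D). \<Sum>u\<in>Pow {1..d}. Tk (kpsi s) u (g u) x)"
    by (auto simp: W_rep_iff)
  have "(\<Sum>u\<in>Pow {1..d}. Tk (kpsi s) u (g u) x)
      = (\<Sum>v\<in>Pow {1..d}. Tk (kpsi s') v (switch \<sigma> {1..d} g v) x)" if x: "x \<in> PiE {1..d} (\<lambda>_. D)" for x
    using x by (intro sum_Tk_switch[OF _ p g] kpsi_bounded kpsi_measurable \<sigma>) auto
  then show ?thesis
    unfolding W_rep_iff f using in_Lp_switch[OF _ _ p g] by (auto intro!: restrict_ext)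
qed

text \<open>A member of the space is given by the sum only at points of
  \<open>PiE {1..d} (\<lambda>_. D)\<close>, while the injectivity argument evaluates at arbitrary
  families \<open>x\<close>. Restricting \<open>x\<close> bridges this, since \<open>Tk\<close>
  reads \<open>x\<close> only on its index set.\<close>

lemma W_rep_sum_eq:
  assumes "W_rep s D \<psi> d p f g" "W_rep s D \<psi> d p f h" "\<And>j. j \<in> {1..d} \<Longrightarrow> x j \<in> D"
  shows "(\<Sum>u\<in>Pow {1..d}. Tk (kpsi s) u (g u) x) = (\<Sum>u\<in>Pow {1..d}. Tk (kpsi s) u (h u) x)"
proof -
  let ?x = "restrict x {1..d}"
  have x: "?x \<in> PiE {1..d} (\<lambda>_. D)" using assms(3) by auto
  have "Tk (kpsi s) u G ?x = Tk (kpsi s) u G x" if "u \<in> Pow {1..d}" for u G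
  proof -
    have "(\<Prod>j\<in>u. kpsi s (?x j) (t j)) = (\<Prod>j\<in>u. kpsi s (x j) (t j))" for t
      using that by (intro prod.cong) auto
    then show ?thesis by (simp add: Tk_def)
  qed
  then have sum_x: "(\<Sum>u\<in>Pow {1..d}. Tk (kpsi s) u (G u) ?x) = (\<Sum>u\<in>Pow {1..d}. Tk (kpsi s) u (G u) x)" for G
    by (rule sum.cong[OF refl])
  have f_x: "f ?x = (\<Sum>u\<in>Pow {1..d}. Tk (kpsi s) u (G u) ?x)" if "W_rep s D \<psi> d p f G" for G
  proof -
    from that have "f = (\<lambda>x \<in> PiE {1..d} (\<lambda>_. D). \<Sum>u\<in>Pow {1..d}. Tk (kpsi s) u (G u) x)"
      unfolding W_rep_iff by (rule conjunct2)
    from fun_cong[OF this, of ?x] restrict_apply'[OF x] show ?thesis by (rule trans)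
  qed
  show ?thesis
    using f_x[OF assms(1)] f_x[OF assms(2)] unfolding sum_x by (rule trans[OF sym])
qed

text \<open>The anchored kernel vanishes at 0, as \<open>sum_Tk_injective\<close> demands of the
  anchor. For the ANOVA kernel the difference of two representations is first switched to the
  anchored kernel; its switched components vanish, and by \<open>switch_AE_zero\<close> so do the
  original ones.\<close>

lemma W_rep_unique:
  assumes g: "W_rep s D \<psi> d p f g" and h: "W_rep s D \<psi> d p f h" and p: "1 \<le> p"
    and u: "u \<in> Pow {1..d}"
  shows "AE t in PM u. g u t = h u t"
proof -
  have gh: "in_Lp p (PM u) (g u)" "in_Lp p (PM u) (h u)" if "u \<in> Pow {1..d}" for u
    using g h that by (auto simp: W_rep_iff)
  then have int: "integrable (PM u) (g u)" "integrable (PM u) (h u)" if "u \<in> Pow {1..d}" for u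
    using gh[OF that] p by (auto intro: prob_space.in_Lp_integrable[OF prob_space_PM])
  define \<delta> where "\<delta> u t = g u t - h u t" for u t
  have \<delta>_Lp: "in_Lp p (PM u) (\<delta> u)" if "u \<in> Pow {1..d}" for u
    using in_Lp_add[OF PM_nonzero p gh(1)[OF that] in_Lp_cmult[OF gh(2)[OF that], of "-1"]]
    by (simp add: \<delta>_def[abs_def])
  have zero: "(\<Sum>u\<in>Pow {1..d}. Tk (kpsi s) u (\<delta> u) x) = 0" if x: "\<And>j. j \<in> {1..d} \<Longrightarrow> x j \<in> D" for x
  proof -
    have "(\<Sum>u\<in>Pow {1..d}. Tk (kpsi s) u (\<delta> u) x)
        = (\<Sum>u\<in>Pow {1..d}. Tk (kpsi s) u (g u) x - Tk (kpsi s) u (h u) x)"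
    proof (intro sum.cong refl)
      fix u assume u: "u \<in> Pow {1..d}"
      then have "finite u" using finite_subset[of u "{1..d}"] by simp
      with u x show "Tk (kpsi s) u (\<delta> u) x = Tk (kpsi s) u (g u) x - Tk (kpsi s) u (h u) x"
        unfolding \<delta>_def[abs_def]
        by (intro Tk_diff int kpsi_measurable kpsi_bounded) auto
    qed
    then show ?thesis using W_rep_sum_eq[OF g h x] by (simp add: sum_subtractf)
  qed
  have anchored: "AE t in PM v. \<eta> v t = 0"
    if \<eta>: "\<And>v. v \<in> Pow {1..d} \<Longrightarrow> in_Lp p (PM v) (\<eta> v)"
      and zero: "\<And>x. (\<And>j. j \<in> {1..d} \<Longrightarrow> x j \<in> D) \<Longrightarrow>
        (\<Sum>v\<in>Pow {1..d}. Tk (kpsi Anchored) v (\<eta> v) x) = 0"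
      and v: "v \<in> Pow {1..d}" for \<eta> v
  proof (rule sum_Tk_injective[where X = D and z = 0, OF _ _ _ _ zero_in_D _ _ zero v])
    show "integrable (PM v) (\<eta> v)" if "v \<in> Pow {1..d}" for v
      using \<eta>[OF that] p by (rule_tac prob_space.in_Lp_integrable[OF prob_space_PM])
    show "kpsi Anchored 0 t = 0" for t by (simp add: kpsi_def)
  qed (simp_all add: kpsi_measurable kpsi_bounded kpsi_separating)
  have "AE t in PM u. \<delta> u t = 0"
  proof (cases s)
    case Anchored
    with anchored[OF \<delta>_Lp _ u] zero show ?thesis by simp
  next
    case Anova
    show ?thesis
    proof (rule switch_AE_zero[OF _ _ _ u])
      fix v assume v: "v \<in> Pow {1..d}"
      show "\<delta> v \<in> borel_measurable (PM v)" using \<delta>_Lp[OF v] by (rule in_Lp_measurable)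
      show "AE t in PM v. switch (-1) {1..d} \<delta> v t = 0"
      proof (rule anchored[OF _ _ v])
        show "in_Lp p (PM v) (switch (-1) {1..d} \<delta> v)" if "v \<in> Pow {1..d}" for v
          using in_Lp_switch[OF _ that p \<delta>_Lp] by simp
        fix x :: "nat \<Rightarrow> real" assume x: "\<And>j. j \<in> {1..d} \<Longrightarrow> x j \<in> D"
        have "(\<Sum>u\<in>Pow {1..d}. Tk (kpsi Anova) u (\<delta> u) x)
            = (\<Sum>v\<in>Pow {1..d}. Tk (kpsi Anchored) v (switch (-1) {1..d} \<delta> v) x)"
          using x by (intro sum_Tk_switch[OF _ p \<delta>_Lp] kpsi_bounded kpsi_measurable kpsi_Anova) auto
        with zero[OF x] Anova
        show "(\<Sum>v\<in>Pow {1..d}. Tk (kpsi Anchored) v (switch (-1) {1..d} \<delta> v) x) = 0" by simp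
      qed
    qed simp
  qed
  then show ?thesis by eventually_elim (simp add: \<delta>_def)
qed

text \<open>Uniqueness up to null sets gives all representations the same component norms, so the
  definite description in \<open>W_norm\<close> denotes their common value.\<close>

lemma W_norm_eq:
  assumes g: "W_rep s D \<psi> d p f g" and p: "1 \<le> p"
  shows "W_norm s D \<psi> d p q \<gamma> f = weighted_lq d q \<gamma> (\<lambda>u. Lp_norm p (PM u) (g u))"
proof -
  have cong: "weighted_lq d q \<gamma> a = weighted_lq d q \<gamma> b" if "\<And>u. u \<in> Pow {1..d} \<Longrightarrow> a u = b u" for a b
    using that unfolding weighted_lq_def by (auto intro!: arg_cong[where f = Max] image_cong sum.cong
        arg_cong[where f = "\<lambda>x. x powr _"])
  have wp: "weighted_power D \<psi> u = PM u" if "u \<in> Pow {1..d}" for u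
    using that finite_subset[of u "{1..d}"] by (intro weighted_power_eq) simp
  have wlq: "weighted_lq d q \<gamma> (\<lambda>u. Lp_norm p (weighted_power D \<psi> u) (h u))
      = weighted_lq d q \<gamma> (\<lambda>u. Lp_norm p (PM u) (h u))" for h
    using wp by (intro cong) simp
  show ?thesis
    unfolding W_norm_def wlq
  proof (rule the_equality)
    show "\<exists>h. W_rep s D \<psi> d p f h \<and>
        weighted_lq d q \<gamma> (\<lambda>u. Lp_norm p (PM u) (g u)) = weighted_lq d q \<gamma> (\<lambda>u. Lp_norm p (PM u) (h u))"
      using g by blast
    fix r assume "\<exists>h. W_rep s D \<psi> d p f h \<and> r = weighted_lq d q \<gamma> (\<lambda>u. Lp_norm p (PM u) (h u))"
    then obtain h where h: "W_rep s D \<psi> d p f h" and r: "r = weighted_lq d q \<gamma> (\<lambda>u. Lp_norm p (PM u) (h u))"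
      by blast
    show "r = weighted_lq d q \<gamma> (\<lambda>u. Lp_norm p (PM u) (g u))"
      unfolding r
    proof (intro cong Lp_norm_AE_cong)
      fix u assume u: "u \<in> Pow {1..d}"
      show "AE t in PM u. h u t = g u t" using h g p u by (rule W_rep_unique)
      show "h u \<in> borel_measurable (PM u)" "g u \<in> borel_measurable (PM u)"
        using u g h unfolding W_rep_iff by (auto intro!: in_Lp_measurable)
    qed
  qed
qed

section \<open>Upper and lower bounds for the operator norm\<close>

lemma id_opnorm_le:
  assumes d: "1 \<le> d" and p: "1 \<le> p" and q: "1 \<le> q" and abs: "\<bar>\<sigma>\<bar> = 1"
    and \<sigma>: "\<And>x t. kpsi s x t = kpsi s' x t + \<sigma> * ratio t"
  shows "id_opnorm s s' D \<psi> d p q (dim_weight d) \<le> ennreal ((1 + rate p / d) ^ d)"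
  unfolding id_opnorm_def
proof (rule SUP_least)
  fix f assume "f \<in> {f \<in> W_space s D \<psi> d p. W_norm s D \<psi> d p q (dim_weight d) f \<le> 1}"
  then obtain g where g: "W_rep s D \<psi> d p f g" and le1: "W_norm s D \<psi> d p q (dim_weight d) f \<le> 1"
    by (auto simp: W_space_def)
  let ?h = "switch \<sigma> {1..d} g"
  have gLp: "in_Lp p (PM u) (g u)" if "u \<in> Pow {1..d}" for u
    using g that by (simp add: W_rep_iff)
  \<comment> \<open>Thus \<open>f\<close> lies in the target space and the value infinity in
    \<open>id_opnorm\<close> does not occur. The sign \<open>\<sigma>\<close> enters the estimate
    only through its modulus, so both directions get the same bound.\<close>
  have h: "W_rep s' D \<psi> d p f ?h" using g p \<sigma> by (rule W_rep_switch)
  have "weighted_lq d q (dim_weight d) (\<lambda>u. Lp_norm p (PM u) (?h u))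
      \<le> (1 + rate p / d) ^ d * weighted_lq d q (dim_weight d) (\<lambda>u. Lp_norm p (PM u) (g u))"
    using Lp_norm_switch_le[OF _ _ p abs gLp]
    by (intro weighted_lq_dim_weight_le d q rate_nonneg Lp_norm_nonneg[OF PM_nonzero]) auto
  also have "\<dots> \<le> (1 + rate p / d) ^ d * 1"
    using le1 rate_nonneg[of p] unfolding W_norm_eq[OF g p] by (intro mult_left_mono) auto
  finally have "W_norm s' D \<psi> d p q (dim_weight d) f \<le> (1 + rate p / d) ^ d"
    by (simp add: W_norm_eq[OF h p])
  then show "(if f \<in> W_space s' D \<psi> d p then ennreal (W_norm s' D \<psi> d p q (dim_weight d) f) else \<infinity>)
      \<le> ennreal ((1 + rate p / d) ^ d)"
    using h by (auto simp: W_space_def intro!: ennreal_leI)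
qed

text \<open>
  Test functions with components \<open>c u * (\<Prod>j\<in>u. \<phi> (t j))\<close>: for \<open>q = \<infinity>\<close> the signs \<open>(-1) ^ card u\<close> make
  all contributions to the component with index \<open>{}\<close> add up; for \<open>q = 1\<close> the component with index
  \<open>{1..d}\<close> alone is spread over all subsets.
\<close>

lemma id_opnorm_ge:
  assumes d: "1 \<le> d" and p: "1 \<le> p" and q: "q \<in> {1, \<infinity>}"
    and \<phi>: "in_Lp p \<mu> \<phi>" "\<And>u. finite u \<Longrightarrow> Lp_norm p (PM u) (\<lambda>t. \<Prod>j\<in>u. \<phi> (t j)) = 1"
    and c: "integrable \<mu> (\<lambda>t. \<phi> t * ratio t)" "c = (\<integral>t. \<phi> t * ratio t \<partial>\<mu>)" "0 \<le> c"
  shows "ennreal ((1 + c / d) ^ d) \<le> id_opnorm Anova Anchored D \<psi> d p q (dim_weight d)"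
proof -
  let ?N = "{1..d}"
  define b where "b = (\<lambda>u. if q = \<infinity> then (-1) ^ card u * dim_weight d u
    else if u = ?N then dim_weight d u else 0)"
  define g where "g = (\<lambda>u t. b u * (\<Prod>j\<in>u. \<phi> (t j)))"
  define f where "f = (\<lambda>x \<in> PiE ?N (\<lambda>_. D). \<Sum>u\<in>Pow ?N. Tk (kpsi Anova) u (g u) x)"
  define h where "h = switch (-1) ?N g"
  \<comment> \<open>By \<open>switch_power\<close>, \<open>h v\<close> is \<open>e v\<close> times
    the product function, whose norm is 1.\<close>
  define e where "e v = (\<Sum>w\<in>Pow (?N - v). (- c) ^ card w * b (v \<union> w))" for v
  have fin: "finite u" if "u \<in> Pow ?N" for u using that finite_subset[of u ?N] by simp
  have pos: "0 < dim_weight d u" for u using d by (simp add: dim_weight_def)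
  have g: "W_rep Anova D \<psi> d p f g"
    using \<phi>(1) fin by (auto simp: W_rep_iff f_def g_def intro!: in_Lp_cmult in_Lp_power)
  have h: "W_rep Anchored D \<psi> d p f h"
    unfolding h_def using g p kpsi_Anova by (rule W_rep_switch)
  have ng: "Lp_norm p (PM u) (g u) = \<bar>b u\<bar>" if "u \<in> Pow ?N" for u
    unfolding g_def using \<phi>(2)[OF fin[OF that]] by (simp add: Lp_norm_cmult[OF PM_nonzero p])
  have nh: "Lp_norm p (PM v) (h v) = \<bar>e v\<bar>" if "v \<in> Pow ?N" for v
  proof -
    have "h v = (\<lambda>t. e v * (\<Prod>j\<in>v. \<phi> (t j)))"
      unfolding h_def g_def e_def c(2) using switch_power[OF _ that c(1), of "-1" b] by (simp add: fun_eq_iff)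
    then show ?thesis using \<phi>(2)[OF fin[OF that]] by (simp add: Lp_norm_cmult[OF PM_nonzero p])
  qed
  have Wg: "W_norm Anova D \<psi> d p q (dim_weight d) f = weighted_lq d q (dim_weight d) (\<lambda>u. Lp_norm p (PM u) (g u))"
    using g p by (rule W_norm_eq)
  have Wh: "W_norm Anchored D \<psi> d p q (dim_weight d) f = weighted_lq d q (dim_weight d) (\<lambda>u. Lp_norm p (PM u) (h u))"
    using h p by (rule W_norm_eq)
  have "W_norm Anova D \<psi> d p q (dim_weight d) f \<le> 1 \<and>
      (1 + c / d) ^ d \<le> W_norm Anchored D \<psi> d p q (dim_weight d) f"
  proof (cases "q = \<infinity>")
    case True
    have "(1 + c / d) ^ d = (\<Sum>w\<in>Pow ?N. (c / d) ^ card w)"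
      by (simp add: sum_Pow_power_card)
    \<comment> \<open>The sign (-1)^|w| in \<open>b\<close> turns (-c)^|w| into c^|w|, and the
      weight turns it into (c / d)^|w|.\<close>
    also have "\<dots> = e {} / dim_weight d {}"
      unfolding e_def b_def using True
      by (auto simp: dim_weight_def power_divide mult.assoc[symmetric] power_mult_distrib[symmetric] intro!: sum.cong)
    also have "\<dots> \<le> Lp_norm p (PM {}) (h {}) / dim_weight d {}"
      using pos[of "{}"] by (simp add: nh divide_right_mono)
    also have "\<dots> \<le> Max ((\<lambda>u. Lp_norm p (PM u) (h u) / dim_weight d u) ` Pow ?N)"
      by (intro Max_ge) auto
    finally have "(1 + c / d) ^ d \<le> W_norm Anchored D \<psi> d p q (dim_weight d) f"
      unfolding Wh weighted_lq_def if_P[OF True] .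
    moreover have "\<bar>b u\<bar> = dim_weight d u" for u
      using True pos[of u] by (simp add: b_def abs_mult power_abs)
    then have "(\<lambda>u. Lp_norm p (PM u) (g u) / dim_weight d u) ` Pow ?N = (\<lambda>u. 1) ` Pow ?N"
      using pos by (intro image_cong refl) (simp add: ng less_imp_neq[symmetric])
    then have "(\<lambda>u. Lp_norm p (PM u) (g u) / dim_weight d u) ` Pow ?N = {1}"
      by (rule trans) (simp add: image_constant_conv Pow_not_empty)
    then have "W_norm Anova D \<psi> d p q (dim_weight d) f \<le> 1"
      unfolding Wg weighted_lq_def if_P[OF True] by simp
    ultimately show ?thesis by simp
  next
    case False
    with q have q1: "q = 1" by auto
    have b: "b u = (if u = ?N then dim_weight d u else 0)" for u
      using False by (simp add: b_def)
    have lq1: "weighted_lq d q (dim_weight d) a = (\<Sum>u\<in>Pow ?N. a u / dim_weight d u)"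
      if "\<And>u. u \<in> Pow ?N \<Longrightarrow> 0 \<le> a u" for a
    proof -
      have nonneg: "0 \<le> a u / dim_weight d u" if "u \<in> Pow ?N" for u
        using \<open>\<And>u. u \<in> Pow ?N \<Longrightarrow> 0 \<le> a u\<close>[OF that] pos[of u] by simp
      then have "(\<Sum>u\<in>Pow ?N. (a u / dim_weight d u) powr 1) = (\<Sum>u\<in>Pow ?N. a u / dim_weight d u)"
        by (intro sum.cong refl powr_one)
      moreover have "0 \<le> (\<Sum>u\<in>Pow ?N. a u / dim_weight d u)"
        using nonneg by (rule sum_nonneg)
      ultimately show ?thesis
        unfolding weighted_lq_def if_not_P[OF False] unfolding q1 enn2real_1 by (simp only: div_by_1 powr_one)
    qed
    have "W_norm Anova D \<psi> d p q (dim_weight d) f = (\<Sum>u\<in>Pow ?N. \<bar>b u\<bar> / dim_weight d u)"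
      unfolding Wg by (subst lq1) (auto simp: ng)
    also have "\<dots> = (\<Sum>u\<in>Pow ?N. if u = ?N then 1 else 0)"
      using pos by (intro sum.cong refl) (auto simp: b abs_of_pos less_imp_neq[symmetric])
    also have "\<dots> = 1" by simp
    finally have "W_norm Anova D \<psi> d p q (dim_weight d) f \<le> 1" by simp
    moreover have "W_norm Anchored D \<psi> d p q (dim_weight d) f = (1 + c / d) ^ d"
    proof -
      have e: "\<bar>e v\<bar> / dim_weight d v = (c / d) ^ card (?N - v)" if v: "v \<in> Pow ?N" for v
      proof -
        have "e v = (\<Sum>w\<in>Pow (?N - v). if w = ?N - v then (- c) ^ card w * dim_weight d ?N else 0)"
          unfolding e_def using v by (intro sum.cong refl) (auto simp: b)
        also have "\<dots> = (- c) ^ card (?N - v) * dim_weight d ?N" by simp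
        finally have "\<bar>e v\<bar> = c ^ card (?N - v) * dim_weight d ?N"
          using c(3) pos[of ?N] by (simp add: abs_mult power_abs)
        moreover have "card ?N = card (?N - v) + card v"
          using v fin[OF v] card_mono[of ?N v] by (simp add: card_Diff_subset)
        ultimately show ?thesis
          using d by (simp add: dim_weight_def power_divide power_add del: card_atLeastAtMost)
      qed
      have "W_norm Anchored D \<psi> d p q (dim_weight d) f = (\<Sum>v\<in>Pow ?N. \<bar>e v\<bar> / dim_weight d v)"
        unfolding Wh by (subst lq1) (auto simp: nh)
      also have "\<dots> = (\<Sum>v\<in>Pow ?N. (c / d) ^ card (?N - v))"
        by (intro sum.cong refl e)
      also have "\<dots> = (\<Sum>w\<in>Pow ?N. (c / d) ^ card w)"
        by (rule sum.reindex_bij_witness[of _ "\<lambda>w. ?N - w" "\<lambda>v. ?N - v"]) auto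
      also have "\<dots> = (1 + c / d) ^ d" by (simp add: sum_Pow_power_card)
      finally show ?thesis .
    qed
    ultimately show ?thesis by simp
  qed
  then have le: "W_norm Anova D \<psi> d p q (dim_weight d) f \<le> 1"
    and ge: "(1 + c / d) ^ d \<le> W_norm Anchored D \<psi> d p q (dim_weight d) f" by auto
  have "ennreal ((1 + c / d) ^ d)
      \<le> (if f \<in> W_space Anchored D \<psi> d p then ennreal (W_norm Anchored D \<psi> d p q (dim_weight d) f) else \<infinity>)"
    using ge by (auto intro: ennreal_leI)
  also have "\<dots> \<le> id_opnorm Anova Anchored D \<psi> d p q (dim_weight d)"
    unfolding id_opnorm_def using g le by (intro SUP_upper) (auto simp: W_space_def)
  finally show ?thesis .
qed

lemma id_opnorm_ge_infinity:
  assumes d: "1 \<le> d" and q: "q \<in> {1, \<infinity>}"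
  shows "ennreal ((1 + m_psi D \<psi> / d) ^ d) \<le> id_opnorm Anova Anchored D \<psi> d \<infinity> q (dim_weight d)"
proof (rule id_opnorm_ge[OF d _ q])
  show "in_Lp \<infinity> \<mu> (\<lambda>_. 1)" by (auto simp: in_Lp_def intro!: exI[of _ 1])
  show "Lp_norm \<infinity> (PM u) (\<lambda>t. \<Prod>j\<in>u. 1) = 1" for u
    using esssup_const[OF PM_nonzero, of u "1::ereal"]
    by (simp add: Lp_norm_def one_ereal_def[symmetric])
  show "m_psi D \<psi> = (\<integral>t. 1 * ratio t \<partial>\<mu>)" "0 \<le> m_psi D \<psi>"
    using rate_infinity rate_nonneg[of \<infinity>] by (auto simp: rate_def)
qed (use integrable_rho in auto)

text \<open>The witness is the normalized indicator of the set where \<open>ratio\<close> exceeds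
  kappa - \<open>\<epsilon>\<close>. This set has positive measure, since otherwise kappa -
  \<open>\<epsilon>\<close> would be an essential bound. The maximum with 0 keeps the bases of later
  powers nonnegative.\<close>

lemma ratio_concentrated:
  assumes \<epsilon>: "0 < \<epsilon>"
  obtains \<phi> where "in_Lp 1 \<mu> \<phi>" "\<And>u. finite u \<Longrightarrow> Lp_norm 1 (PM u) (\<lambda>t. \<Prod>j\<in>u. \<phi> (t j)) = 1"
    "integrable \<mu> (\<lambda>t. \<phi> t * ratio t)" "max 0 (kappa_psi D \<psi> - \<epsilon>) \<le> (\<integral>t. \<phi> t * ratio t \<partial>\<mu>)"
proof -
  let ?k = "kappa_psi D \<psi>"
  define E where "E = {t \<in> space \<mu>. ?k - \<epsilon> < ratio t}"
  have E[measurable]: "E \<in> sets \<mu>" unfolding E_def by measurable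
  have "measure \<mu> E \<noteq> 0"
  proof
    assume "measure \<mu> E = 0"
    then have "E \<in> null_sets \<mu>" using E by (auto simp: null_sets_def emeasure_eq_measure)
    then have "AE t in \<mu>. t \<notin> E" by (rule AE_not_in)
    with AE_space have le: "AE t in \<mu>. ratio t \<le> ?k - \<epsilon>" by eventually_elim (auto simp: E_def)
    have ge: "AE t in \<mu>. 0 \<le> ratio t" using rho_bounds by eventually_elim simp
    from le ge have "AE t in \<mu>. 0 \<le> ?k - \<epsilon>" by eventually_elim simp
    then have nonneg: "0 \<le> ?k - \<epsilon>" by simp
    from le ge have "AE t in L. \<bar>ratio t\<bar> \<le> ?k - \<epsilon>"
      unfolding AE_mu_iff by eventually_elim simp
    then have "Lp_norm \<infinity> L ratio \<le> ?k - \<epsilon>"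
      using Lp_norm_le_infinity_iff[OF L_nonzero nonneg, of ratio] by simp
    with \<epsilon> show False by (simp add: kappa_psi_def ratio_def[abs_def])
  qed
  then have mE: "0 < measure \<mu> E" by (simp add: zero_less_measure_iff)
  define \<phi> where "\<phi> t = indicator E t / measure \<mu> E" for t
  have \<phi>_nonneg: "0 \<le> \<phi> t" for t using mE by (simp add: \<phi>_def)
  have \<phi>_int: "integrable \<mu> \<phi>" unfolding \<phi>_def[abs_def]
    by (intro integrable_divide_zero integrable_real_indicator E) (simp add: emeasure_eq_measure)
  have \<phi>_one: "(\<integral>t. \<phi> t \<partial>\<mu>) = 1"
    using mE sets.sets_into_space[OF E] by (simp add: \<phi>_def[abs_def] Int_absorb2 Int_absorb1)
  have abs_\<phi>: "\<bar>\<phi> t\<bar> powr enn2real 1 = \<phi> t" for t using \<phi>_nonneg[of t] by simp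
  show ?thesis
  proof (rule that)
    show "in_Lp 1 \<mu> \<phi>" using \<phi>_int by (simp add: in_Lp_def abs_\<phi> del: enn2real_1)
    fix u :: "nat set" assume u: "finite u"
    have "\<bar>\<Prod>j\<in>u. \<phi> (t j)\<bar> powr enn2real 1 = (\<Prod>j\<in>u. \<phi> (t j))" for t
      using \<phi>_nonneg by (simp add: prod_nonneg)
    then show "Lp_norm 1 (PM u) (\<lambda>t. \<Prod>j\<in>u. \<phi> (t j)) = 1"
      using P.product_integral_prod[OF u, of "\<lambda>_. \<phi>"] \<phi>_int \<phi>_one
      by (simp add: Lp_norm_def del: enn2real_1)
  next
    have "AE t in \<mu>. \<bar>ratio t\<bar> \<le> ?k" using rho_bounds by eventually_elim auto
    then show int: "integrable \<mu> (\<lambda>t. \<phi> t * ratio t)"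
      using \<phi>_int by (intro integrable_mult_AE_bounded) auto
    have "(\<integral>t. (?k - \<epsilon>) * \<phi> t \<partial>\<mu>) \<le> (\<integral>t. \<phi> t * ratio t \<partial>\<mu>)"
    proof (rule integral_mono)
      show "(?k - \<epsilon>) * \<phi> t \<le> \<phi> t * ratio t" for t
        using mE by (auto simp: \<phi>_def E_def indicator_def divide_right_mono)
    qed (use int \<phi>_int in auto)
    moreover have "0 \<le> (\<integral>t. \<phi> t * ratio t \<partial>\<mu>)"
      using rho_bounds \<phi>_nonneg by (intro integral_nonneg_AE) (auto elim: eventually_mono)
    ultimately show "max 0 (?k - \<epsilon>) \<le> (\<integral>t. \<phi> t * ratio t \<partial>\<mu>)" by (simp add: \<phi>_one)
  qed
qed

text \<open>The essential supremum kappa need not be attained on a set of positive measure, so the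
  bound is reached as a limit with \<open>\<epsilon>\<close> = 1 / (n + 1).\<close>

lemma id_opnorm_ge_one:
  assumes d: "1 \<le> d" and q: "q \<in> {1, \<infinity>}"
  shows "ennreal ((1 + kappa_psi D \<psi> / d) ^ d) \<le> id_opnorm Anova Anchored D \<psi> d 1 q (dim_weight d)"
proof (rule LIMSEQ_le_const2)
  let ?c = "\<lambda>n. max 0 (kappa_psi D \<psi> - 1 / real (Suc n))"
  have "(\<lambda>n. kappa_psi D \<psi> - 1 / real (Suc n)) \<longlonglongrightarrow> kappa_psi D \<psi> - 0"
    using LIMSEQ_inverse_real_of_nat by (intro tendsto_diff tendsto_const) (simp add: inverse_eq_divide)
  then have "?c \<longlonglongrightarrow> max 0 (kappa_psi D \<psi> - 0)" by (intro tendsto_max tendsto_const)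
  then have "?c \<longlonglongrightarrow> kappa_psi D \<psi>" using kappa_nonneg by (simp add: max_absorb2)
  then show "(\<lambda>n. ennreal ((1 + ?c n / d) ^ d)) \<longlonglongrightarrow> ennreal ((1 + kappa_psi D \<psi> / d) ^ d)"
    using d by (intro tendsto_ennrealI tendsto_power tendsto_add tendsto_const tendsto_divide) auto
  show "\<exists>N. \<forall>n\<ge>N. ennreal ((1 + ?c n / d) ^ d) \<le> id_opnorm Anova Anchored D \<psi> d 1 q (dim_weight d)"
  proof (intro exI allI impI)
    fix n :: nat
    obtain \<phi> where \<phi>: "in_Lp 1 \<mu> \<phi>"
      "\<And>u. finite u \<Longrightarrow> Lp_norm 1 (PM u) (\<lambda>t. \<Prod>j\<in>u. \<phi> (t j)) = 1"
      "integrable \<mu> (\<lambda>t. \<phi> t * ratio t)" "?c n \<le> (\<integral>t. \<phi> t * ratio t \<partial>\<mu>)"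
      using ratio_concentrated[of "1 / real (Suc n)"] by auto
    have "ennreal ((1 + ?c n / d) ^ d) \<le> ennreal ((1 + (\<integral>t. \<phi> t * ratio t \<partial>\<mu>) / d) ^ d)"
      using \<phi>(4) by (intro ennreal_leI power_mono add_left_mono divide_right_mono) auto
    also have "\<dots> \<le> id_opnorm Anova Anchored D \<psi> d 1 q (dim_weight d)"
      using \<phi> by (intro id_opnorm_ge[OF d _ q]) auto
    finally show "ennreal ((1 + ?c n / d) ^ d) \<le> id_opnorm Anova Anchored D \<psi> d 1 q (dim_weight d)" .
  qed
qed

end

lemma one_plus_div_power_le_exp:
  fixes r :: real
  assumes "0 \<le> r" "1 \<le> d"
  shows "(1 + r / real d) ^ d \<le> exp r"
proof -
  have "(1 + r / real d) ^ d \<le> exp (r / real d) ^ d"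
    using assms by (intro power_mono exp_ge_add_one_self) auto
  also have "\<dots> = exp r" using assms by (simp flip: exp_of_nat_mult)
  finally show ?thesis .
qed

theorem mainTheorem8:
  fixes D :: "real set" and \<psi> :: "real \<Rightarrow> real"
  assumes "admissible_interval D"
    and "admissible_density D \<psi>"
    and "integrability_condition D \<psi> 1"
  shows "(\<forall>q\<in>{1, \<infinity>}. \<forall>d\<ge>1.
            id_opnorm Anova Anchored D \<psi> d 1 q (dim_weight d)
              = ennreal ((1 + kappa_psi D \<psi> / real d) ^ d) \<and>
            (1 + kappa_psi D \<psi> / real d) ^ d \<le> exp (kappa_psi D \<psi>) \<and>
            id_opnorm Anova Anchored D \<psi> d \<infinity> q (dim_weight d)
              = ennreal ((1 + m_psi D \<psi> / real d) ^ d) \<and>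
            (1 + m_psi D \<psi> / real d) ^ d \<le> exp (m_psi D \<psi>)) \<and>
         (\<forall>p\<ge>1. \<forall>q\<ge>1.
            (SUP d\<in>{1..}. id_opnorm Anova Anchored D \<psi> d p q (dim_weight d)) < \<infinity> \<and>
            (SUP d\<in>{1..}. id_opnorm Anchored Anova D \<psi> d p q (dim_weight d)) < \<infinity>)"
proof -
  interpret weighted_setting D \<psi> using assms by unfold_locales
  have Anchored: "kpsi Anchored x t = kpsi Anova x t + 1 * ratio t" for x t
    by (simp add: kpsi_Anova)
  have le: "id_opnorm Anova Anchored D \<psi> d p q (dim_weight d) \<le> ennreal ((1 + rate p / d) ^ d)"
    "id_opnorm Anchored Anova D \<psi> d p q (dim_weight d) \<le> ennreal ((1 + rate p / d) ^ d)"
    if "1 \<le> p" "1 \<le> q" "1 \<le> d" for p q d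
    using that id_opnorm_le[OF _ _ _ _ kpsi_Anova] id_opnorm_le[OF _ _ _ _ Anchored] by auto
  have exp: "(1 + rate p / d) ^ d \<le> exp (rate p)" if "1 \<le> d" for p d
    using rate_nonneg that by (rule one_plus_div_power_le_exp)
  \<comment> \<open>The rate depends on p but not on d, so its exponential bounds the norms for all
    d at once.\<close>
  have bound: "(SUP d\<in>{1..}. F d) < \<infinity>"
    if "\<And>d. 1 \<le> d \<Longrightarrow> F d \<le> ennreal ((1 + rate p / d) ^ d)" for F p
  proof -
    have "(SUP d\<in>{1..}. F d) \<le> ennreal (exp (rate p))"
      by (intro SUP_least order_trans[OF that ennreal_leI[OF exp]]) auto
    also have "\<dots> < \<infinity>" by simp
    finally show ?thesis .
  qed
  show ?thesis
  proof (intro conjI ballI allI impI)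
    fix q :: ennreal and d :: nat assume q: "q \<in> {1, \<infinity>}" and d: "1 \<le> d"
    have q1: "1 \<le> q" using q by auto
    show "id_opnorm Anova Anchored D \<psi> d 1 q (dim_weight d) = ennreal ((1 + kappa_psi D \<psi> / real d) ^ d)"
      using le(1)[of 1 q d] q1 d id_opnorm_ge_one[OF d q] by (intro antisym) (auto simp: rate_one)
    show "id_opnorm Anova Anchored D \<psi> d \<infinity> q (dim_weight d) = ennreal ((1 + m_psi D \<psi> / real d) ^ d)"
      using le(1)[of \<infinity> q d, unfolded rate_infinity] q1 d id_opnorm_ge_infinity[OF d q] by (intro antisym) auto
    show "(1 + kappa_psi D \<psi> / real d) ^ d \<le> exp (kappa_psi D \<psi>)"
      using exp[OF d, of 1] by (simp add: rate_one)
    show "(1 + m_psi D \<psi> / real d) ^ d \<le> exp (m_psi D \<psi>)"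
      using exp[OF d, of \<infinity>] by (simp only: rate_infinity)
  next
    fix p q :: ennreal assume pq: "1 \<le> p" "1 \<le> q"
    show "(SUP d\<in>{1..}. id_opnorm Anova Anchored D \<psi> d p q (dim_weight d)) < \<infinity>"
      using le(1)[OF pq] by (rule bound)
    show "(SUP d\<in>{1..}. id_opnorm Anchored Anova D \<psi> d p q (dim_weight d)) < \<infinity>"
      using le(2)[OF pq] by (rule bound)
  qed
qed

end
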